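(* In the gap-rule setting described in the context, consider the two conditions $$(H1'):\ \min_{\ell_1\ne\ell_2\in[m],\ \ell_1'\ne\ell_2'\notin[m]}\left(\tilde z_{\ell_1,\ell_1'}+\tilde s_{\ell_1,\ell_2,\ell_1',\ell_2'}\right)\ge\min_{A\in\mathcal{G}_m^1}2r_A,$$ $$(H2'):\ \min_{\ell_1\ne\ell_2\in[m],\ \ell_1'\ne\ell_2'\notin[m]}2\tilde s_{\ell_1,\ell_2,\ell_1',\ell_2'}\ge\min_{A\in\mathcal{G}_m^1}2r_A.$$ Under either condition, $r_*=\min_{A\in\mathcal{G}_m^1}r_A$. Further, define $\widetilde\Theta^{(0)}=\{\beta^A:A\in\mathcal{G}_m^1\}$ and $$\widetilde\Theta^{(1)}=\widetilde\Theta^{(0)}\cup\{\tilde\gamma^{\ell,\ell'}:\ell\in[m],\ell'\notin[m]\},$$ $$\widetilde\Theta^{(2)}=\widetilde\Theta^{(0)}\cup\{\tilde\gamma^{\ell_1,\ell_2,\ell_1',\ell_2'}:\ell_1\ne\ell_2\in[m],\ \ell_1'\ne\ell_2'\notin[m]\}.$$ If $(H1')$ holds, then $\mathbb{P}_{\widetilde\Theta^{(1)}}$ is asymptotically efficient for estimating $\mathbb{P}(\tau_b^*<\tau_b^{[m]})$. If $(H2')$ holds, then $\mathbb{P}_{\widetilde\Theta^{(2)}}$ is asymptotically efficient for estimating $\mathbb{P}(\tau_b^*<\tau_b^{[m]})$.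
   Context: $X_1,X_2,\ldots$ are i.i.d. $\mathbb{R}^d$-valued random vectors on $(\Omega,\mathcal{F},\mathbb{P})$; $S_0=0$, $S_n=\sum_{i\le n}X_i$, $\mathcal{F}_n=\sigma(X_1,\ldots,X_n)$. $\Lambda(\theta)=\log\mathbb{E}[e^{\theta\cdot X_1}]$, $\Lambda^*(x)=\sup_\theta\{\theta\cdot x-\Lambda(\theta)\}$, $I(x)=\sup\{\theta\cdot x:\Lambda(\theta)\le0\}$; $\operatorname{dom}(f)=\{f<\infty\}$, $\operatorname{cone}(A)=\{\lambda x:\lambda>0,x\in A\}$; $[m]=\{1,\dots,m\}$. Gap rule: $2\le m\le d-2$, $\mathbb{E}[X_{1,k}]>0$ for $1\le k\le m$ and $\mathbb{E}[X_{1,k}]<0$ for $m+1\le k\le d$. $\mathcal{G}_m=\{A\subset[d]:|A|=m\}$, $\mathcal{G}_m^-=\mathcal{G}_m\setminus\{[m]\}$, and $\mathcal{G}_m^1=\{([m]\setminus\{k\})\cup\{k'\}:k\in[m],k'\in[d]\setminus[m]\}$. For $A\in\mathcal{G}_m$, $W^A=\{x\in\mathbb{R}^d:x_k-x_{k'}>1\text{ for all }k\in A,k'\in A^c\}$ and $\tau_b^A=\inf\{n\ge0:S_n\in bW^A\}$ ($b>0$, $\inf\emptyset=\infty$); $\tau_b^*=\min_{A\in\mathcal{G}_m^-}\tau_b^A$. Standing assumption: $\operatorname{dom}(\Lambda)$ is open and $\operatorname{int}(\operatorname{cone}(\operatorname{dom}(\Lambda^* )))\cap W^A\ne\emptyset$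 for every $A\in\mathcal{G}_m^-$. For $A\in\mathcal{G}_m^-$: $r_A=\inf_{x\in W^A}I(x)$, $r_*=\min_{A\in\mathcal{G}_m^-}r_A$, and $\beta^A$ is the unique vector with $\Lambda(\beta^A)=0$, $W^A\subset\{v:\beta^A\cdot v\ge r_A\}$, $\{x:I(x)\le r_A\}\subset\{v:\beta^A\cdot v\le r_A\}$ (existence and uniqueness are known). Indices outside $[m]$ range over $[d]\setminus[m]$. For $\ell\in[m]$, $\ell'\notin[m]$, $\tilde z_{\ell,\ell'}$ and $\tilde\gamma^{\ell,\ell'}$ are the optimal value and solution of $$\max_{\theta\in\mathbb{R}^d}\theta_{\ell'}\ \text{ s.t. }\ \Lambda(\theta)\le0,\ \theta_\ell+\theta_{\ell'}=0,\ \theta_\ell\le0,\ \theta_{\ell'}\ge0,\ \theta_k=0\text{ for }k\notin\{\ell,\ell'\}.$$ For $\ell_1\ne\ell_2\in[m]$ and $\ell_1'\ne\ell_2'\notin[m]$, $\tilde s_{\ell_1,\ell_2,\ell_1',\ell_2'}$ and $\tilde\gamma^{\ell_1,\ell_2,\ell_1',\ell_2'}$ are the optimal value and solution of $$\max_{\theta\in\mathbb{R}^d}\theta_{\ell_1'}+\theta_{\ell_2'}\ \text{ s.t. }\ \Lambda(\theta)\le0,\ \theta_{\ell_1}+\theta_{\ell_2}+\theta_{\ell_1'}+\theta_{\ell_2'}=0,\ \theta_{\ell_1},\theta_{\ell_2}\le0,\ \theta_{\ell_1'},\theta_{\ell_2'}\ge0,\ \theta_k=0\text{ for }k\notin\{\ell_1,\ell_2,\ell_1',\ell_2'\}.$$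 For $\theta\in\operatorname{dom}(\Lambda)$, $\mathbb{P}_\theta$ is the probability measure with $\frac{d\mathbb{P}_\theta}{d\mathbb{P}}(\mathcal{F}_n)=\exp(\theta\cdot S_n-n\Lambda(\theta))$ for all $n$. For finite nonempty $\Theta\subset\operatorname{dom}(\Lambda)$, $\mathbb{P}_\Theta=\frac1{|\Theta|}\sum_{\theta\in\Theta}\mathbb{P}_\theta$ (expectation $\mathbb{E}_\Theta$) and $$\widehat{\mathbb{W}}_b(\Theta)=\Big(\frac1{|\Theta|}\sum_{\theta\in\Theta}\exp(\theta\cdot S_{\tau_b^*}-\tau_b^*\Lambda(\theta))\Big)^{-1}\mathbf 1\{\tau_b^*<\tau_b^{[m]}\}.$$ $\mathbb{P}_\Theta$ is asymptotically efficient for estimating $\mathbb{P}(\tau_b^*<\tau_b^{[m]})$ if $\log\mathbb{E}_\Theta[(\widehat{\mathbb{W}}_b(\Theta))^2]\big/\big(2\log\mathbb{P}(\tau_b^*<\tau_b^{[m]})\big)\to1$ as $b\to\infty$. *)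

theory Defs
  imports "HOL-Probability.Probability"
begin

text \<open>
  Vectors in \<open>\<real>\<^sup>d\<close> are elements of \<open>real ^ 'n\<close> with \<open>d = CARD('n)\<close>, so that \<open>'n\<close> is the
  set \<open>[d]\<close> of coordinate labels.  The block \<open>[m]\<close> of the coordinates with positive mean is a set
  \<open>J :: 'n set\<close> with \<open>m = card J\<close>, and \<open>[d] \ [m]\<close> is \<open>- J\<close>.  The sequence
  \<open>X\<^sub>1, X\<^sub>2, \<dots>\<close> is \<open>X 1, X 2, \<dots>\<close>; the value \<open>X 0\<close> is never used.
\<close>

definition cgf :: "'a measure \<Rightarrow> ('a \<Rightarrow> real ^ 'n) \<Rightarrow> real ^ 'n \<Rightarrow> ereal" where
  "cgf M Y \<theta> =
     (let e = (\<integral>\<^sup>+ \<omega>. ennreal (exp (\<theta> \<bullet> Y \<omega>)) \<partial>M)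
      in if e = \<infinity> then \<infinity> else ereal (ln (enn2real e)))"

definition edom :: "('b \<Rightarrow> ereal) \<Rightarrow> 'b set" where
  "edom f = {x. f x < \<infinity>}"

definition open_cone :: "'b::real_vector set \<Rightarrow> 'b set" where
  "open_cone A = {c *\<^sub>R x | c x. 0 < c \<and> x \<in> A}"

definition conjugate :: "(real ^ 'n \<Rightarrow> ereal) \<Rightarrow> real ^ 'n \<Rightarrow> ereal" where
  "conjugate \<Lambda> x = (SUP \<theta>. ereal (\<theta> \<bullet> x) - \<Lambda> \<theta>)"

definition rate_fn :: "(real ^ 'n \<Rightarrow> ereal) \<Rightarrow> real ^ 'n \<Rightarrow> ereal" where
  "rate_fn \<Lambda> x = (SUP \<theta>\<in>{\<theta>. \<Lambda> \<theta> \<le> 0}. ereal (\<theta> \<bullet> x))"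

definition G_all :: "'n::finite set \<Rightarrow> 'n set set" where
  "G_all J = {A. card A = card J}"

definition G_minus :: "'n::finite set \<Rightarrow> 'n set set" where
  "G_minus J = G_all J - {J}"

definition G_one :: "'n::finite set \<Rightarrow> 'n set set" where
  "G_one J = {(J - {k}) \<union> {k'} | k k'. k \<in> J \<and> k' \<notin> J}"

definition W :: "'n set \<Rightarrow> (real ^ 'n) set" where
  "W A = {x. \<forall>k\<in>A. \<forall>k'\<in>- A. x $ k - x $ k' > 1}"

definition S :: "(nat \<Rightarrow> 'a \<Rightarrow> real ^ 'n) \<Rightarrow> nat \<Rightarrow> 'a \<Rightarrow> real ^ 'n" where
  "S X n \<omega> = (\<Sum>i\<in>{1..n}. X i \<omega>)"

definition hit :: "(nat \<Rightarrow> 'a \<Rightarrow> real ^ 'n) \<Rightarrow> real \<Rightarrow> 'n set \<Rightarrow> 'a \<Rightarrow> enat" where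
  "hit X b A \<omega> = Inf (enat ` {n. S X n \<omega> \<in> (\<lambda>x. b *\<^sub>R x) ` W A})"

definition hit_star :: "(nat \<Rightarrow> 'a \<Rightarrow> real ^ 'n::finite) \<Rightarrow> real \<Rightarrow> 'n set \<Rightarrow> 'a \<Rightarrow> enat" where
  "hit_star X b J \<omega> = Min ((\<lambda>A. hit X b A \<omega>) ` G_minus J)"

definition r_set :: "(real ^ 'n \<Rightarrow> ereal) \<Rightarrow> 'n set \<Rightarrow> ereal" where
  "r_set \<Lambda> A = (INF x\<in>W A. rate_fn \<Lambda> x)"

definition r_star :: "(real ^ 'n::finite \<Rightarrow> ereal) \<Rightarrow> 'n set \<Rightarrow> ereal" where
  "r_star \<Lambda> J = Min (r_set \<Lambda> ` G_minus J)"

definition beta :: "(real ^ 'n \<Rightarrow> ereal) \<Rightarrow> 'n set \<Rightarrow> real ^ 'n" where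
  "beta \<Lambda> A = (THE \<beta>. \<Lambda> \<beta> = 0
      \<and> W A \<subseteq> {v. ereal (\<beta> \<bullet> v) \<ge> r_set \<Lambda> A}
      \<and> {x. rate_fn \<Lambda> x \<le> r_set \<Lambda> A} \<subseteq> {v. ereal (\<beta> \<bullet> v) \<le> r_set \<Lambda> A})"

definition feas2 :: "(real ^ 'n \<Rightarrow> ereal) \<Rightarrow> 'n \<Rightarrow> 'n \<Rightarrow> (real ^ 'n) set" where
  "feas2 \<Lambda> l l' = {\<theta>. \<Lambda> \<theta> \<le> 0 \<and> \<theta> $ l + \<theta> $ l' = 0 \<and> \<theta> $ l \<le> 0 \<and> \<theta> $ l' \<ge> 0
      \<and> (\<forall>k. k \<notin> {l, l'} \<longrightarrow> \<theta> $ k = 0)}"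

definition z_val :: "(real ^ 'n \<Rightarrow> ereal) \<Rightarrow> 'n \<Rightarrow> 'n \<Rightarrow> ereal" where
  "z_val \<Lambda> l l' = (SUP \<theta>\<in>feas2 \<Lambda> l l'. ereal (\<theta> $ l'))"

definition gamma2 :: "(real ^ 'n \<Rightarrow> ereal) \<Rightarrow> 'n \<Rightarrow> 'n \<Rightarrow> real ^ 'n" where
  "gamma2 \<Lambda> l l' = arg_max_on (\<lambda>\<theta>. \<theta> $ l') (feas2 \<Lambda> l l')"

definition feas4 :: "(real ^ 'n \<Rightarrow> ereal) \<Rightarrow> 'n \<Rightarrow> 'n \<Rightarrow> 'n \<Rightarrow> 'n \<Rightarrow> (real ^ 'n) set" where
  "feas4 \<Lambda> l1 l2 l1' l2' = {\<theta>. \<Lambda> \<theta> \<le> 0 \<and> \<theta> $ l1 + \<theta> $ l2 + \<theta> $ l1' + \<theta> $ l2' = 0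
      \<and> \<theta> $ l1 \<le> 0 \<and> \<theta> $ l2 \<le> 0 \<and> \<theta> $ l1' \<ge> 0 \<and> \<theta> $ l2' \<ge> 0
      \<and> (\<forall>k. k \<notin> {l1, l2, l1', l2'} \<longrightarrow> \<theta> $ k = 0)}"

definition s_val :: "(real ^ 'n \<Rightarrow> ereal) \<Rightarrow> 'n \<Rightarrow> 'n \<Rightarrow> 'n \<Rightarrow> 'n \<Rightarrow> ereal" where
  "s_val \<Lambda> l1 l2 l1' l2' = (SUP \<theta>\<in>feas4 \<Lambda> l1 l2 l1' l2'. ereal (\<theta> $ l1' + \<theta> $ l2'))"

definition gamma4 :: "(real ^ 'n \<Rightarrow> ereal) \<Rightarrow> 'n \<Rightarrow> 'n \<Rightarrow> 'n \<Rightarrow> 'n \<Rightarrow> real ^ 'n" where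
  "gamma4 \<Lambda> l1 l2 l1' l2' = arg_max_on (\<lambda>\<theta>. \<theta> $ l1' + \<theta> $ l2') (feas4 \<Lambda> l1 l2 l1' l2')"

definition quads :: "'n set \<Rightarrow> ('n \<times> 'n \<times> 'n \<times> 'n) set" where
  "quads J = {(l1, l2, l1', l2'). l1 \<in> J \<and> l2 \<in> J \<and> l1 \<noteq> l2 \<and> l1' \<notin> J \<and> l2' \<notin> J \<and> l1' \<noteq> l2'}"

definition H1 :: "(real ^ 'n::finite \<Rightarrow> ereal) \<Rightarrow> 'n set \<Rightarrow> bool" where
  "H1 \<Lambda> J \<longleftrightarrow>
     Min ((\<lambda>(l1, l2, l1', l2'). z_val \<Lambda> l1 l1' + s_val \<Lambda> l1 l2 l1' l2') ` quads J)
       \<ge> Min ((\<lambda>A. 2 * r_set \<Lambda> A) ` G_one J)"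

definition H2 :: "(real ^ 'n::finite \<Rightarrow> ereal) \<Rightarrow> 'n set \<Rightarrow> bool" where
  "H2 \<Lambda> J \<longleftrightarrow>
     Min ((\<lambda>(l1, l2, l1', l2'). 2 * s_val \<Lambda> l1 l2 l1' l2') ` quads J)
       \<ge> Min ((\<lambda>A. 2 * r_set \<Lambda> A) ` G_one J)"

definition Theta0 :: "(real ^ 'n::finite \<Rightarrow> ereal) \<Rightarrow> 'n set \<Rightarrow> (real ^ 'n) set" where
  "Theta0 \<Lambda> J = beta \<Lambda> ` G_one J"

definition Theta1 :: "(real ^ 'n::finite \<Rightarrow> ereal) \<Rightarrow> 'n set \<Rightarrow> (real ^ 'n) set" where
  "Theta1 \<Lambda> J = Theta0 \<Lambda> J \<union> {gamma2 \<Lambda> l l' | l l'. l \<in> J \<and> l' \<notin> J}"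

definition Theta2 :: "(real ^ 'n::finite \<Rightarrow> ereal) \<Rightarrow> 'n set \<Rightarrow> (real ^ 'n) set" where
  "Theta2 \<Lambda> J = Theta0 \<Lambda> J
     \<union> {gamma4 \<Lambda> l1 l2 l1' l2' | l1 l2 l1' l2'. (l1, l2, l1', l2') \<in> quads J}"

definition filt :: "'a measure \<Rightarrow> (nat \<Rightarrow> 'a \<Rightarrow> real ^ 'n) \<Rightarrow> nat \<Rightarrow> 'a set set" where
  "filt M X n = sigma_sets (space M) {X i -` B \<inter> space M | i B. i \<in> {1..n} \<and> B \<in> sets borel}"

text \<open>The exponential martingale \<open>exp (\<theta> \<cdot> S\<^sub>n - n \<Lambda>(\<theta>))\<close>, meaningful for \<open>\<theta>\<close> in the domain of \<open>\<Lambda>\<close>.\<close>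

definition lik :: "'a measure \<Rightarrow> (nat \<Rightarrow> 'a \<Rightarrow> real ^ 'n) \<Rightarrow> real ^ 'n \<Rightarrow> nat \<Rightarrow> 'a \<Rightarrow> real" where
  "lik M X \<theta> n \<omega> = exp (\<theta> \<bullet> S X n \<omega> - real n * real_of_ereal (cgf M (X 1) \<theta>))"

text \<open>
  \<open>P\<close> is the measure \<open>\<P>\<^sub>\<theta>\<close>.  On a general measurable space such a measure is determined only on
  the \<open>\<sigma>\<close>-algebra generated by all the \<open>X\<^sub>i\<close>, and need not exist (it does on the path space of the
  sequence), hence a predicate rather than a function of \<open>\<theta>\<close>.
\<close>

definition tilted :: "'a measure \<Rightarrow> (nat \<Rightarrow> 'a \<Rightarrow> real ^ 'n) \<Rightarrow> real ^ 'n \<Rightarrow> 'a measure \<Rightarrow> bool" where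
  "tilted M X \<theta> P \<longleftrightarrow> prob_space P \<and> sets P = sets M \<and>
     (\<forall>n. \<forall>E\<in>filt M X n. emeasure P E = (\<integral>\<^sup>+ \<omega>\<in>E. ennreal (lik M X \<theta> n \<omega>) \<partial>M))"

definition mixture ::
  "'a measure \<Rightarrow> ('b \<Rightarrow> 'a measure) \<Rightarrow> 'b set \<Rightarrow> 'a measure" where
  "mixture M Q \<Theta> = measure_of (space M) (sets M)
     (\<lambda>E. (\<Sum>\<theta>\<in>\<Theta>. emeasure (Q \<theta>) E) / of_nat (card \<Theta>))"

text \<open>The random variable \<open>\<tau>\<^sup>*\<close> is finite on the event of the indicator.\<close>

definition W_hat :: "'a measure \<Rightarrow> (nat \<Rightarrow> 'a \<Rightarrow> real ^ 'n::finite) \<Rightarrow> 'n set \<Rightarrow>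
    (real ^ 'n) set \<Rightarrow> real \<Rightarrow> 'a \<Rightarrow> real" where
  "W_hat M X J \<Theta> b \<omega> =
     (if hit_star X b J \<omega> < hit X b J \<omega>
      then inverse ((\<Sum>\<theta>\<in>\<Theta>. lik M X \<theta> (the_enat (hit_star X b J \<omega>)) \<omega>) / real (card \<Theta>))
      else 0)"

definition err_prob :: "'a measure \<Rightarrow> (nat \<Rightarrow> 'a \<Rightarrow> real ^ 'n::finite) \<Rightarrow> 'n set \<Rightarrow> real \<Rightarrow> real" where
  "err_prob M X J b = measure M {\<omega> \<in> space M. hit_star X b J \<omega> < hit X b J \<omega>}"

text \<open>
  If the second moment were infinite (integral \<open>0\<close> by convention) or if the probability were \<open>0\<close>,
  then \<open>ln 0 = 0\<close> would make the quotient \<open>0\<close>, so the limit \<open>1\<close> implies that, for all large \<open>b\<close>,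
  the second moment is finite and the probability is positive.
\<close>

definition asymp_efficient :: "'a measure \<Rightarrow> (nat \<Rightarrow> 'a \<Rightarrow> real ^ 'n::finite) \<Rightarrow> 'n set \<Rightarrow>
    (real ^ 'n \<Rightarrow> 'a measure) \<Rightarrow> (real ^ 'n) set \<Rightarrow> bool" where
  "asymp_efficient M X J Q \<Theta> \<longleftrightarrow>
     ((\<lambda>b. ln (\<integral>\<omega>. (W_hat M X J \<Theta> b \<omega>)\<^sup>2 \<partial>mixture M Q \<Theta>) / (2 * ln (err_prob M X J b)))
        \<longlongrightarrow> 1) at_top"

lemma emeasure_mixture:
  fixes M :: "'a measure"
  assumes "\<And>\<theta>. \<theta> \<in> \<Theta> \<Longrightarrow> sets (Q \<theta>) = sets M" and "E \<in> sets M"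
  shows "emeasure (mixture M Q \<Theta>) E = (\<Sum>\<theta>\<in>\<Theta>. emeasure (Q \<theta>) E) / of_nat (card \<Theta>)"
proof -
  let ?\<mu> = "\<lambda>E. (\<Sum>\<theta>\<in>\<Theta>. emeasure (Q \<theta>) E) / of_nat (card \<Theta>)"
  have "countably_additive (sets M) ?\<mu>"
  proof (rule countably_additiveI)
    fix F :: "nat \<Rightarrow> 'a set"
    assume F: "range F \<subseteq> sets M" "disjoint_family F"
    have "(\<Sum>i. ?\<mu> (F i)) = (\<Sum>\<theta>\<in>\<Theta>. \<Sum>i. emeasure (Q \<theta>) (F i)) / of_nat (card \<Theta>)"
      by (simp add: ennreal_suminf_divide suminf_sum)
    also have "\<dots> = ?\<mu> (\<Union> (range F))"
      using F assms(1) by (auto intro!: sum.cong arg_cong2[where f="(/)"] suminf_emeasure)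
    finally show "(\<Sum>i. ?\<mu> (F i)) = ?\<mu> (\<Union> (range F))" .
  qed
  moreover have "positive (sets M) ?\<mu>"
    by (simp add: positive_def)
  ultimately show ?thesis
    using emeasure_measure_of_sigma[of "space M" "sets M" ?\<mu> E] assms(2)
    unfolding mixture_def by (simp add: sets.sigma_algebra_axioms)
qed

end

theory Submission
  imports Defs "HOL-Real_Asymp.Real_Asymp"
begin

text \<open>
  The functionals \<open>\<theta>\<close> that are bounded below on \<open>W A\<close> form the cone \<open>block_cone A\<close> of transport plans
  from the coordinates outside \<open>A\<close> to those inside, and \<open>\<theta> \<bullet> x \<ge> mass A \<theta>\<close> on \<open>W A\<close>. Hence \<open>r_set \<Lambda> A\<close>
  dominates the maximum of \<open>mass A\<close> over \<open>{\<Lambda> \<le> 0} \<inter> block_cone A\<close>. Conversely, the first-order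
  condition at a maximizer \<open>\<beta>\<close>, tested on the directions \<open>e\<^sub>k - e\<^sub>k\<^sub>'\<close>, shows that a multiple of the
  tilted mean \<open>\<nabla>\<Lambda>(\<beta>)\<close> lies in the closure of \<open>W A\<close> and has rate \<open>mass A \<beta>\<close>. This gives strong
  duality and identifies \<open>\<beta>\<close> with \<open>\<beta>\<^sup>A\<close>.

  For the second moment, the event of first entering \<open>b W A\<close> contributes at most a constant times
  \<open>exp (- b (mass A \<theta> + mass A \<theta>'))\<close>, where \<open>\<theta> \<in> \<Theta>\<close> bounds the estimator and \<open>\<theta>'\<close> the probability.
  For \<open>A\<close> a single swap both are \<open>\<beta>\<^sup>A\<close>; for the other \<open>A\<close> the sum is controlled by (H1') or (H2').
  Jensen's inequality bounds the second moment below by the squared error probability, and a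
  Chernoff bound under \<open>\<P>\<^sub>\<beta>\<close> shows that the latter decays no faster than \<open>exp (- b r)\<close>.
\<close>

subsection \<open>Convexity of the moment generating function\<close>

text \<open>Taylor's formula with Lagrange remainder, whose intermediate point satisfies |t| \<le>
  |x|. Applied to a small tilt \<open>t * y\<close>, it bounds the moment generating function by a
  first-order expansion plus a quadratic error.\<close>

lemma exp_le_quadratic: "exp x \<le> 1 + x + x\<^sup>2 * exp \<bar>x\<bar>" for x :: real
proof -
  obtain t where t: "\<bar>t\<bar> \<le> \<bar>x\<bar>"
    "exp x = (\<Sum>m<2. x ^ m / fact m) + exp t / fact 2 * x ^ 2"
    using Maclaurin_exp_le[of x 2] by auto
  have "exp t / 2 * x\<^sup>2 \<le> exp \<bar>x\<bar> * x\<^sup>2"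
  proof (rule mult_right_mono)
    have "exp t \<le> exp \<bar>x\<bar>" using t(1) by simp
    moreover have "0 < exp t" by simp
    ultimately show "exp t / 2 \<le> exp \<bar>x\<bar>" by linarith
  qed simp
  then show ?thesis using t(2) by (simp add: numeral_2_eq_2 mult.commute)
qed

text \<open>One half of the exponent \<eta> |y| absorbs the factor \<open>y\<^sup>2\<close>, since
  \<open>z\<^sup>2 / 2 \<le> exp z\<close>; the other half absorbs the tilt. The bound is integrable
  against \<open>exp (\<theta> \<bullet> Y \<omega>)\<close> when the shifts of \<theta> by \<eta>
  to both sides stay in the domain.\<close>

lemma square_times_exp_le:
  fixes y t \<eta> :: real
  assumes "0 < \<eta>" "\<bar>t\<bar> \<le> \<eta> / 2"
  shows "y\<^sup>2 * exp \<bar>t * y\<bar> \<le> 8 / \<eta>\<^sup>2 * (exp (\<eta> * y) + exp (- (\<eta> * y)))"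
proof -
  define z where "z = \<eta> * \<bar>y\<bar> / 2"
  have z: "0 \<le> z" using assms by (simp add: z_def)
  have "y\<^sup>2 = 4 / \<eta>\<^sup>2 * z\<^sup>2"
    using assms(1) by (simp add: z_def power_mult_distrib power_divide)
  also have "\<dots> \<le> 4 / \<eta>\<^sup>2 * (2 * exp z)"
    using exp_lower_Taylor_quadratic[OF z] z by (intro mult_left_mono) auto
  finally have 1: "y\<^sup>2 \<le> 8 / \<eta>\<^sup>2 * exp z" by simp
  have "\<bar>t * y\<bar> \<le> z"
    using mult_right_mono[OF assms(2), of "\<bar>y\<bar>"] by (simp add: z_def abs_mult)
  then have "y\<^sup>2 * exp \<bar>t * y\<bar> \<le> 8 / \<eta>\<^sup>2 * exp z * exp z"
    using 1 by (intro mult_mono) auto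
  also have "\<dots> = 8 / \<eta>\<^sup>2 * exp (\<eta> * \<bar>y\<bar>)"
    by (simp add: z_def exp_add[symmetric])
  also have "\<dots> \<le> 8 / \<eta>\<^sup>2 * (exp (\<eta> * y) + exp (- (\<eta> * y)))"
    by (intro mult_left_mono) (auto simp: abs_if)
  finally show ?thesis .
qed

section \<open>The cone of transport plans and its pairing with \<open>W A\<close>\<close>

definition block_cone :: "'n set \<Rightarrow> (real ^ 'n::finite) set" where
  "block_cone A = {\<theta>. (\<forall>k\<in>A. 0 \<le> \<theta> $ k) \<and> (\<forall>k\<in>- A. \<theta> $ k \<le> 0) \<and> (\<Sum>k\<in>UNIV. \<theta> $ k) = 0}"

definition mass :: "'n set \<Rightarrow> real ^ 'n::finite \<Rightarrow> real" where
  "mass A \<theta> = (\<Sum>k\<in>A. \<theta> $ k)"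

text \<open>The plan that moves one unit of mass from \<open>k'\<close> to \<open>k\<close>. Testing
  optimality on these plans yields one inequality for each pair of coordinates.\<close>

definition swap_dir :: "'n \<Rightarrow> 'n \<Rightarrow> real ^ 'n::finite" where
  "swap_dir k k' = axis k 1 - axis k' 1"

lemma inner_swap_dir [simp]: "swap_dir k k' \<bullet> x = x $ k - x $ k'" for x :: "real ^ 'n::finite"
  by (simp add: swap_dir_def inner_diff_left inner_axis')

lemma swap_dir_in_block_cone:
  assumes "k \<in> A" "k' \<notin> A"
  shows "swap_dir k k' \<in> block_cone A" "mass A (swap_dir k k') = 1"
proof -
  have *: "swap_dir k k' $ j = (if j = k then 1 else 0) - (if j = k' then 1 else 0)" for j
    by (simp add: swap_dir_def axis_def)
  show "swap_dir k k' \<in> block_cone A" "mass A (swap_dir k k') = 1"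
    using assms by (auto simp: block_cone_def mass_def * sum_subtractf)
qed

lemma block_cone_scale: "\<theta> \<in> block_cone A \<Longrightarrow> 0 \<le> c \<Longrightarrow> c *\<^sub>R \<theta> \<in> block_cone A"
  by (auto simp: block_cone_def sum_distrib_left[symmetric] mult_nonneg_nonpos)

lemma block_cone_add: "\<theta> \<in> block_cone A \<Longrightarrow> \<theta>' \<in> block_cone A \<Longrightarrow> \<theta> + \<theta>' \<in> block_cone A"
  by (auto simp: block_cone_def sum.distrib intro: add_nonpos_nonpos)

lemma mass_scale: "mass A (c *\<^sub>R \<theta>) = c * mass A \<theta>"
  by (simp add: mass_def sum_distrib_left)

lemma mass_add: "mass A (\<theta> + \<theta>') = mass A \<theta> + mass A \<theta>'"
  by (simp add: mass_def sum.distrib)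

text \<open>The coordinates sum to zero, so the negative part outside \<open>A\<close> balances the
  positive part inside. Hence \<open>mass A\<close> is half the l1 norm on the cone and controls the
  size of its elements.\<close>

lemma block_cone_abs_sum:
  fixes \<theta> :: "real ^ 'n::finite"
  assumes "\<theta> \<in> block_cone A"
  shows "(\<Sum>k\<in>UNIV. \<bar>\<theta> $ k\<bar>) = 2 * mass A \<theta>"
proof -
  have eq: "(\<Sum>k\<in>UNIV. f k) = (\<Sum>k\<in>A. f k) + (\<Sum>k\<in>-A. f k)" for f :: "'n \<Rightarrow> real"
    using sum.subset_diff[of A UNIV f] by (simp add: Compl_eq_Diff_UNIV)
  have "(\<Sum>k\<in>A. \<bar>\<theta> $ k\<bar>) = mass A \<theta>" "(\<Sum>k\<in>-A. \<bar>\<theta> $ k\<bar>) = - (\<Sum>k\<in>-A. \<theta> $ k)"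
    using assms by (auto simp: block_cone_def mass_def sum_negf[symmetric] intro!: sum.cong)
  then show ?thesis
    using assms eq[of "\<lambda>k. \<bar>\<theta> $ k\<bar>"] eq[of "\<lambda>k. \<theta> $ k"] by (simp add: block_cone_def mass_def)
qed

lemma block_cone_norm_le: "\<theta> \<in> block_cone A \<Longrightarrow> norm \<theta> \<le> 2 * mass A \<theta>"
  using norm_le_l1_cart[of \<theta>] block_cone_abs_sum[of \<theta> A] by simp

text \<open>Since \<theta> sums to zero, a common shift of all coordinates of \<open>x\<close>
  leaves \<open>\<theta> \<bullet> x\<close> unchanged. Shifting by the largest coordinate outside
  \<open>A\<close> makes every term outside \<open>A\<close> nonnegative and every term
  \<open>k\<close> inside at least \<open>g * \<theta> $ k\<close>.\<close>

lemma block_cone_inner_ge: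
  fixes x :: "real ^ 'n::finite"
  assumes \<theta>: "\<theta> \<in> block_cone A" and A: "A \<noteq> UNIV"
    and x: "\<And>k k'. k \<in> A \<Longrightarrow> k' \<notin> A \<Longrightarrow> x $ k - x $ k' \<ge> g"
  shows "\<theta> \<bullet> x \<ge> g * mass A \<theta>"
proof -
  define c where "c = Max ((\<lambda>k. x $ k) ` (- A))"
  have c1: "x $ k \<le> c" if "k \<notin> A" for k
    using that by (simp add: c_def)
  have "c \<in> (\<lambda>k. x $ k) ` (- A)"
    unfolding c_def using A by (intro Max_in) auto
  then have c2: "x $ k \<ge> c + g" if "k \<in> A" for k
    using x[OF that] by force
  have "\<theta> \<bullet> x = (\<Sum>k\<in>UNIV. \<theta> $ k * (x $ k - c)) + c * (\<Sum>k\<in>UNIV. \<theta> $ k)"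
    by (simp add: inner_vec_def algebra_simps sum_distrib_left sum_subtractf)
  also have "\<dots> = (\<Sum>k\<in>UNIV. \<theta> $ k * (x $ k - c))"
    using \<theta> by (simp add: block_cone_def)
  also have "\<dots> \<ge> (\<Sum>k\<in>UNIV. if k \<in> A then \<theta> $ k * g else 0)"
  proof (rule sum_mono)
    fix k
    show "(if k \<in> A then \<theta> $ k * g else 0) \<le> \<theta> $ k * (x $ k - c)"
      using \<theta> c1[of k] c2[of k]
      by (auto simp: block_cone_def intro!: mult_left_mono mult_nonpos_nonpos)
  qed
  also have "(\<Sum>k\<in>UNIV. if k \<in> A then \<theta> $ k * g else 0) = g * mass A \<theta>"
    by (simp add: mass_def sum.If_cases sum_distrib_left mult.commute)
  finally show ?thesis .
qed

lemma closed_block_cone: "closed (block_cone A)"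
proof -
  have "block_cone A = (\<Inter>k\<in>A. {\<theta>. 0 \<le> \<theta> $ k}) \<inter> (\<Inter>k\<in>-A. {\<theta>. \<theta> $ k \<le> 0})
      \<inter> {\<theta>. (\<Sum>k\<in>UNIV. \<theta> $ k) = 0}"
    by (auto simp: block_cone_def)
  also have "closed \<dots>"
    by (intro closed_Int closed_INT ballI closed_Collect_le closed_Collect_eq continuous_intros)
  finally show ?thesis .
qed

lemma open_W: "open (W A)" for A :: "'n::finite set"
proof -
  have "W A = (\<Inter>k\<in>A. \<Inter>k'\<in>-A. {x. 1 < x $ k - x $ k'})"
    by (auto simp: W_def)
  also have "open \<dots>"
    by (intro open_INT finite ballI open_Collect_less continuous_intros)
  finally show ?thesis .
qed

section \<open>Moment generating function, its gradient and the sublevel set of \<Lambda>\<close>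

locale step_vector = prob_space +
  fixes Y :: "'a \<Rightarrow> real ^ 'n::finite"
  assumes Y [measurable]: "Y \<in> borel_measurable M"
    and open_dom: "open (edom (cgf M Y))"
begin

abbreviation \<Lambda> where "\<Lambda> \<equiv> cgf M Y"

definition mgf :: "real ^ 'n \<Rightarrow> real" where
  "mgf \<theta> = (\<integral>\<omega>. exp (\<theta> \<bullet> Y \<omega>) \<partial>M)"

lemma edom_iff: "\<theta> \<in> edom \<Lambda> \<longleftrightarrow> integrable M (\<lambda>\<omega>. exp (\<theta> \<bullet> Y \<omega>))"
  unfolding edom_def cgf_def Let_def
  by (auto simp: integrable_iff_bounded top.not_eq_extremum)

lemma mgf_pos: assumes "\<theta> \<in> edom \<Lambda>" shows "0 < mgf \<theta>"
proof -
  have "mgf \<theta> \<noteq> 0"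
  proof
    assume "mgf \<theta> = 0"
    then have "AE \<omega> in M. exp (\<theta> \<bullet> Y \<omega>) = 0"
      using assms unfolding mgf_def edom_iff by (subst (asm) integral_nonneg_eq_0_iff_AE) auto
    then show False by simp
  qed
  moreover have "0 \<le> mgf \<theta>" by (simp add: mgf_def)
  ultimately show ?thesis by simp
qed

lemma nn_integral_exp:
  assumes "\<theta> \<in> edom \<Lambda>"
  shows "(\<integral>\<^sup>+ \<omega>. ennreal (exp (\<theta> \<bullet> Y \<omega>)) \<partial>M) = ennreal (mgf \<theta>)"
  unfolding mgf_def using assms by (intro nn_integral_eq_integral) (auto simp: edom_iff)

lemma cgf_eq: assumes "\<theta> \<in> edom \<Lambda>" shows "\<Lambda> \<theta> = ereal (ln (mgf \<theta>))"
  using mgf_pos[OF assms] nn_integral_exp[OF assms] by (simp add: cgf_def)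

lemma cgf_le_0_iff: "\<Lambda> \<theta> \<le> 0 \<longleftrightarrow> \<theta> \<in> edom \<Lambda> \<and> mgf \<theta> \<le> 1"
  using cgf_eq[of \<theta>] mgf_pos[of \<theta>] by (cases "\<theta> \<in> edom \<Lambda>") (auto simp: edom_def)

lemma cgf_eq_0_iff: "\<Lambda> \<theta> = 0 \<longleftrightarrow> \<theta> \<in> edom \<Lambda> \<and> mgf \<theta> = 1"
  using cgf_eq[of \<theta>] mgf_pos[of \<theta>] by (cases "\<theta> \<in> edom \<Lambda>") (auto simp: edom_def)

lemma mgf_0: "mgf 0 = 1" "0 \<in> edom \<Lambda>"
  by (auto simp: mgf_def edom_iff prob_space)

lemma cgf_0: "\<Lambda> 0 = 0" by (simp add: cgf_eq_0_iff mgf_0)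

lemma edom_line:
  assumes "\<theta> \<in> edom \<Lambda>"
  obtains \<eta> where "0 < \<eta>" "\<theta> + \<eta> *\<^sub>R u \<in> edom \<Lambda>" "\<theta> - \<eta> *\<^sub>R u \<in> edom \<Lambda>"
proof -
  obtain e where e: "0 < e" "ball \<theta> e \<subseteq> edom \<Lambda>"
    using open_dom assms by (meson open_contains_ball)
  \<comment> \<open>The summand 1 in the denominator covers \<open>u = 0\<close>.\<close>
  define \<eta> where "\<eta> = e / (2 * (norm u + 1))"
  have n: "0 < norm u + 1" using norm_ge_zero[of u] by linarith
  have \<eta>: "0 < \<eta>" using e n by (simp add: \<eta>_def)
  have "\<eta> * norm u < \<eta> * (2 * (norm u + 1))" using \<eta> n by (intro mult_strict_left_mono) auto
  also have "\<dots> = e" using n by (simp add: \<eta>_def)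
  finally have "norm (\<eta> *\<^sub>R u) < e" using \<eta> by simp
  then have "\<theta> + \<eta> *\<^sub>R u \<in> ball \<theta> e" "\<theta> - \<eta> *\<^sub>R u \<in> ball \<theta> e"
    by (auto simp: dist_norm)
  then show thesis using that \<eta> e by blast
qed

text \<open>Domination replaces differentiation under the integral: integrating the pointwise
  quadratic bound for \<open>exp\<close> gives the first-order term in direction \<open>u\<close>
  with error \<open>C * t\<^sup>2\<close>, for \<open>t\<close> of either sign. Openness of the
  domain supplies the room on both sides of \<theta>.\<close>

lemma mgf_line_bound:
  assumes \<theta>: "\<theta> \<in> edom \<Lambda>"
  obtains \<eta> C where "0 < \<eta>" "0 \<le> C" "integrable M (\<lambda>\<omega>. (u \<bullet> Y \<omega>) * exp (\<theta> \<bullet> Y \<omega>))"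
    "\<And>t. \<bar>t\<bar> \<le> \<eta> \<Longrightarrow> \<theta> + t *\<^sub>R u \<in> edom \<Lambda> \<and>
      mgf (\<theta> + t *\<^sub>R u) \<le> mgf \<theta> + t * (\<integral>\<omega>. (u \<bullet> Y \<omega>) * exp (\<theta> \<bullet> Y \<omega>) \<partial>M) + C * t\<^sup>2"
proof -
  obtain \<eta> where \<eta>: "0 < \<eta>" "\<theta> + \<eta> *\<^sub>R u \<in> edom \<Lambda>" "\<theta> - \<eta> *\<^sub>R u \<in> edom \<Lambda>"
    using edom_line[OF \<theta>] by blast
  \<comment> \<open>A majorant of the second-order remainder that serves for all |t| \<le> \<eta> /
    2 at once.\<close>
  define h where "h \<omega> = 8 / \<eta>\<^sup>2 * (exp ((\<theta> + \<eta> *\<^sub>R u) \<bullet> Y \<omega>) + exp ((\<theta> - \<eta> *\<^sub>R u) \<bullet> Y \<omega>))" for \<omega>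
  define y where "y \<omega> = u \<bullet> Y \<omega>" for \<omega>
  define e where "e \<omega> = exp (\<theta> \<bullet> Y \<omega>)" for \<omega>
  have [measurable]: "y \<in> borel_measurable M" "e \<in> borel_measurable M"
    by (simp_all add: y_def[abs_def] e_def[abs_def])
  have epos: "0 < e \<omega>" for \<omega> by (simp add: e_def)
  have hi: "integrable M h"
    unfolding h_def using \<eta> by (auto simp: edom_iff)
  have ei: "integrable M e" using \<theta> by (simp add: e_def[abs_def] edom_iff)
  have hpos: "0 \<le> h \<omega>" for \<omega> by (simp add: h_def)
  have sq: "(y \<omega>)\<^sup>2 * exp \<bar>t * y \<omega>\<bar> * e \<omega> \<le> h \<omega>" if "\<bar>t\<bar> \<le> \<eta> / 2" for t \<omega>
  proof -
    have "(y \<omega>)\<^sup>2 * exp \<bar>t * y \<omega>\<bar> * e \<omega>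
        \<le> 8 / \<eta>\<^sup>2 * (exp (\<eta> * y \<omega>) + exp (- (\<eta> * y \<omega>))) * e \<omega>"
      using square_times_exp_le[OF \<eta>(1) that] epos[of \<omega>] by (intro mult_right_mono) auto
    also have "\<dots> = h \<omega>"
      by (simp add: h_def e_def y_def exp_add[symmetric] algebra_simps)
    finally show ?thesis .
  qed
  have yi: "integrable M (\<lambda>\<omega>. y \<omega> * e \<omega>)"
  proof (rule Bochner_Integration.integrable_bound)
    show "integrable M (\<lambda>\<omega>. e \<omega> + h \<omega>)" using ei hi by simp
    show "AE \<omega> in M. norm (y \<omega> * e \<omega>) \<le> norm (e \<omega> + h \<omega>)"
    proof (rule AE_I2)
      fix \<omega>
      have "\<bar>y \<omega>\<bar> \<le> 1 + (y \<omega>)\<^sup>2"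
      proof (cases "\<bar>y \<omega>\<bar> \<le> 1")
        case False
        then show ?thesis using self_le_power[of "\<bar>y \<omega>\<bar>" 2] by simp
      qed (use zero_le_power2[of "y \<omega>"] in linarith)
      then have "\<bar>y \<omega>\<bar> * e \<omega> \<le> (1 + (y \<omega>)\<^sup>2) * e \<omega>"
        using epos[of \<omega>] by (intro mult_right_mono) auto
      also have "\<dots> \<le> e \<omega> + h \<omega>"
        using sq[of 0 \<omega>] \<eta> by (simp add: algebra_simps)
      finally show "norm (y \<omega> * e \<omega>) \<le> norm (e \<omega> + h \<omega>)"
        using epos[of \<omega>] hpos[of \<omega>] by (simp add: abs_mult)
    qed
  qed simp
  have main: "\<theta> + t *\<^sub>R u \<in> edom \<Lambda> \<and>
      mgf (\<theta> + t *\<^sub>R u) \<le> mgf \<theta> + t * (\<integral>\<omega>. y \<omega> * e \<omega> \<partial>M) + (\<integral>\<omega>. h \<omega> \<partial>M) * t\<^sup>2"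
    if t: "\<bar>t\<bar> \<le> \<eta> / 2" for t
  proof -
    have bd: "exp ((\<theta> + t *\<^sub>R u) \<bullet> Y \<omega>) \<le> e \<omega> + t * (y \<omega> * e \<omega>) + h \<omega> * t\<^sup>2" for \<omega>
    proof -
      have "exp ((\<theta> + t *\<^sub>R u) \<bullet> Y \<omega>) = exp (t * y \<omega>) * e \<omega>"
        by (simp add: e_def y_def exp_add[symmetric] algebra_simps)
      also have "\<dots> \<le> (1 + t * y \<omega> + (t * y \<omega>)\<^sup>2 * exp \<bar>t * y \<omega>\<bar>) * e \<omega>"
        using exp_le_quadratic[of "t * y \<omega>"] epos[of \<omega>] by (intro mult_right_mono) auto
      also have "\<dots> = e \<omega> + t * (y \<omega> * e \<omega>) + ((y \<omega>)\<^sup>2 * exp \<bar>t * y \<omega>\<bar> * e \<omega>) * t\<^sup>2"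
        by (simp add: algebra_simps power_mult_distrib)
      also have "\<dots> \<le> e \<omega> + t * (y \<omega> * e \<omega>) + h \<omega> * t\<^sup>2"
        using sq[OF t, of \<omega>] by (intro add_left_mono mult_right_mono) auto
      finally show ?thesis .
    qed
    have gi: "integrable M (\<lambda>\<omega>. e \<omega> + t * (y \<omega> * e \<omega>) + h \<omega> * t\<^sup>2)"
      using ei yi hi by simp
    have i: "integrable M (\<lambda>\<omega>. exp ((\<theta> + t *\<^sub>R u) \<bullet> Y \<omega>))"
      by (rule Bochner_Integration.integrable_bound[OF gi])
        (use bd in \<open>auto intro!: AE_I2 order_trans[OF bd]\<close>)
    have "mgf (\<theta> + t *\<^sub>R u) \<le> (\<integral>\<omega>. e \<omega> + t * (y \<omega> * e \<omega>) + h \<omega> * t\<^sup>2 \<partial>M)"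
      unfolding mgf_def using i gi bd by (intro integral_mono) auto
    also have "\<dots> = mgf \<theta> + t * (\<integral>\<omega>. y \<omega> * e \<omega> \<partial>M) + (\<integral>\<omega>. h \<omega> \<partial>M) * t\<^sup>2"
      using ei yi hi by (simp add: mgf_def e_def[abs_def, symmetric])
    finally show ?thesis using i by (simp add: edom_iff)
  qed
  show thesis
  proof (rule that[of "\<eta> / 2" "\<integral>\<omega>. h \<omega> \<partial>M"])
    show "0 \<le> (\<integral>\<omega>. h \<omega> \<partial>M)" by (simp add: hpos)
  qed (use \<eta> main yi in \<open>auto simp: y_def e_def\<close>)
qed

text \<open>The gradient of \<open>mgf\<close> at \<theta>. Where \<open>mgf \<theta> = 1\<close> it
  is the mean of \<open>Y\<close> under the law tilted by \<theta>.\<close>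

definition tmean :: "real ^ 'n \<Rightarrow> real ^ 'n" where
  "tmean \<theta> = (\<chi> k. \<integral>\<omega>. Y \<omega> $ k * exp (\<theta> \<bullet> Y \<omega>) \<partial>M)"

lemma integrable_inner_exp:
  "\<theta> \<in> edom \<Lambda> \<Longrightarrow> integrable M (\<lambda>\<omega>. (u \<bullet> Y \<omega>) * exp (\<theta> \<bullet> Y \<omega>))"
  using mgf_line_bound[of \<theta> u] by blast

lemma inner_tmean:
  assumes "\<theta> \<in> edom \<Lambda>"
  shows "(\<integral>\<omega>. (u \<bullet> Y \<omega>) * exp (\<theta> \<bullet> Y \<omega>) \<partial>M) = u \<bullet> tmean \<theta>"
proof -
  have i: "integrable M (\<lambda>\<omega>. Y \<omega> $ k * exp (\<theta> \<bullet> Y \<omega>))" for k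
    using integrable_inner_exp[OF assms, of "axis k 1"] by (simp add: inner_axis')
  have "(\<integral>\<omega>. (u \<bullet> Y \<omega>) * exp (\<theta> \<bullet> Y \<omega>) \<partial>M)
      = (\<integral>\<omega>. (\<Sum>k\<in>UNIV. u $ k * (Y \<omega> $ k * exp (\<theta> \<bullet> Y \<omega>))) \<partial>M)"
    by (simp add: inner_vec_def sum_distrib_right mult.assoc)
  also have "\<dots> = (\<Sum>k\<in>UNIV. u $ k * (\<integral>\<omega>. Y \<omega> $ k * exp (\<theta> \<bullet> Y \<omega>) \<partial>M))"
    using i by (subst Bochner_Integration.integral_sum) auto
  finally show ?thesis by (simp add: tmean_def inner_vec_def)
qed

lemma mgf_direction:
  assumes \<theta>: "\<theta> \<in> edom \<Lambda>"
  obtains \<eta> C where "0 < \<eta>" "0 \<le> C"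
    "\<And>t. \<bar>t\<bar> \<le> \<eta> \<Longrightarrow> \<theta> + t *\<^sub>R u \<in> edom \<Lambda>"
    "\<And>t. \<bar>t\<bar> \<le> \<eta> \<Longrightarrow> mgf (\<theta> + t *\<^sub>R u) \<le> mgf \<theta> + t * (u \<bullet> tmean \<theta>) + C * t\<^sup>2"
  by (rule mgf_line_bound[OF \<theta>, of u], rule that) (auto simp: inner_tmean[OF \<theta>])

lemma mgf_decreasing_direction:
  assumes \<theta>: "\<theta> \<in> edom \<Lambda>" and u: "u \<bullet> tmean \<theta> < 0"
  obtains t0 where "0 < t0"
    "\<And>t. 0 < t \<Longrightarrow> t \<le> t0 \<Longrightarrow> \<theta> + t *\<^sub>R u \<in> edom \<Lambda> \<and> mgf (\<theta> + t *\<^sub>R u) < mgf \<theta>"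
proof -
  obtain \<eta> C where \<eta>: "0 < \<eta>" "0 \<le> C"
    "\<And>t. \<bar>t\<bar> \<le> \<eta> \<Longrightarrow> \<theta> + t *\<^sub>R u \<in> edom \<Lambda>"
    "\<And>t. \<bar>t\<bar> \<le> \<eta> \<Longrightarrow> mgf (\<theta> + t *\<^sub>R u) \<le> mgf \<theta> + t * (u \<bullet> tmean \<theta>) + C * t\<^sup>2"
    by (rule mgf_direction[OF \<theta>, of u], rule that)
  \<comment> \<open>For \<open>t\<close> up to this bound, \<open>(C + 1) * t\<close> is at most the
    absolute slope, so the linear decrease strictly beats \<open>C * t\<^sup>2\<close>.\<close>
  define t0 where "t0 = min \<eta> (- (u \<bullet> tmean \<theta>) / (C + 1))"
  have t0: "0 < t0" using \<eta> u by (simp add: t0_def divide_neg_pos)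
  have "\<theta> + t *\<^sub>R u \<in> edom \<Lambda> \<and> mgf (\<theta> + t *\<^sub>R u) < mgf \<theta>" if t: "0 < t" "t \<le> t0" for t
  proof -
    have "t \<le> - (u \<bullet> tmean \<theta>) / (C + 1)" using t by (simp add: t0_def)
    then have "t * (C + 1) \<le> - (u \<bullet> tmean \<theta>)"
      using \<eta>(2) by (subst (asm) pos_le_divide_eq) auto
    then have "C * t + u \<bullet> tmean \<theta> < 0" using t by (simp add: algebra_simps)
    then have "t * (C * t + u \<bullet> tmean \<theta>) < 0" using t by (simp add: mult_pos_neg)
    then show ?thesis
      using \<eta>(3)[of t] \<eta>(4)[of t] t by (auto simp: t0_def algebra_simps power2_eq_square)
  qed
  then show thesis using t0 that by blast
qed

text \<open>Integrate \<open>1 + x \<le> exp x\<close> at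
  \<open>x = (\<theta> - \<beta>) \<bullet> Y \<omega>\<close> against the weight
  \<open>exp (\<beta> \<bullet> Y \<omega>)\<close>. Equality of the integrals forces equality
  almost surely, and \<open>exp x = 1 + x\<close> holds only at 0.\<close>

lemma mgf_gradient_ineq:
  assumes "\<beta> \<in> edom \<Lambda>" "\<theta> \<in> edom \<Lambda>"
  shows "mgf \<beta> + (\<theta> - \<beta>) \<bullet> tmean \<beta> \<le> mgf \<theta>"
    and "mgf \<beta> + (\<theta> - \<beta>) \<bullet> tmean \<beta> = mgf \<theta> \<Longrightarrow> AE \<omega> in M. (\<theta> - \<beta>) \<bullet> Y \<omega> = 0"
proof -
  define f where "f \<omega> = exp (\<theta> \<bullet> Y \<omega>) - exp (\<beta> \<bullet> Y \<omega>) - ((\<theta> - \<beta>) \<bullet> Y \<omega>) * exp (\<beta> \<bullet> Y \<omega>)" for \<omega>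
  note i = assms[unfolded edom_iff] integrable_inner_exp[OF assms(1), of "\<theta> - \<beta>"]
  have f: "f \<omega> = exp (\<beta> \<bullet> Y \<omega>) * (exp ((\<theta> - \<beta>) \<bullet> Y \<omega>) - 1 - (\<theta> - \<beta>) \<bullet> Y \<omega>)" for \<omega>
    by (simp add: f_def algebra_simps exp_add[symmetric])
  have fpos: "0 \<le> f \<omega>" for \<omega>
    unfolding f using exp_ge_add_one_self[of "(\<theta> - \<beta>) \<bullet> Y \<omega>"]
    by (intro mult_nonneg_nonneg) (auto simp del: exp_ge_add_one_self)
  have fi: "integrable M f" using i by (simp add: f_def[abs_def])
  have int: "(\<integral>\<omega>. f \<omega> \<partial>M) = mgf \<theta> - mgf \<beta> - (\<theta> - \<beta>) \<bullet> tmean \<beta>"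
    unfolding f_def using i by (simp add: mgf_def inner_tmean[OF assms(1)])
  moreover have "0 \<le> (\<integral>\<omega>. f \<omega> \<partial>M)" by (simp add: fpos)
  ultimately show "mgf \<beta> + (\<theta> - \<beta>) \<bullet> tmean \<beta> \<le> mgf \<theta>" by simp
  assume "mgf \<beta> + (\<theta> - \<beta>) \<bullet> tmean \<beta> = mgf \<theta>"
  then have "AE \<omega> in M. f \<omega> = 0"
    using int fi fpos by (subst integral_nonneg_eq_0_iff_AE[symmetric]) auto
  then show "AE \<omega> in M. (\<theta> - \<beta>) \<bullet> Y \<omega> = 0"
  proof eventually_elim
    case (elim \<omega>)
    then have "exp ((\<theta> - \<beta>) \<bullet> Y \<omega>) = 1 + (\<theta> - \<beta>) \<bullet> Y \<omega>" by (simp add: f)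
    then show ?case using exp_minus_greater[of "- ((\<theta> - \<beta>) \<bullet> Y \<omega>)"] by auto
  qed
qed

text \<open>Fatou's lemma makes the extended-valued moment generating function lower semicontinuous.
  Points outside the domain have infinite integral, so a limit of points of the sublevel set cannot
  leave the domain.\<close>

lemma closed_sublevel: "closed {\<theta>. \<Lambda> \<theta> \<le> 0}"
proof -
  have eq: "{\<theta>. \<Lambda> \<theta> \<le> 0} = {\<theta>. (\<integral>\<^sup>+ \<omega>. ennreal (exp (\<theta> \<bullet> Y \<omega>)) \<partial>M) \<le> 1}"
  proof (rule Collect_cong)
    fix \<theta>
    show "\<Lambda> \<theta> \<le> 0 \<longleftrightarrow> (\<integral>\<^sup>+ \<omega>. ennreal (exp (\<theta> \<bullet> Y \<omega>)) \<partial>M) \<le> 1"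
    proof (cases "\<theta> \<in> edom \<Lambda>")
      case True
      then show ?thesis using nn_integral_exp[OF True] mgf_pos[OF True] by (simp add: cgf_le_0_iff)
    next
      case False
      then have "(\<integral>\<^sup>+ \<omega>. ennreal (exp (\<theta> \<bullet> Y \<omega>)) \<partial>M) = \<infinity>"
        by (auto simp: edom_def cgf_def Let_def split: if_splits)
      then show ?thesis using False by (simp add: cgf_le_0_iff top_unique)
    qed
  qed
  show ?thesis
    unfolding closed_sequential_limits
  proof (intro allI impI)
    fix x l assume x: "(\<forall>n. x n \<in> {\<theta>. \<Lambda> \<theta> \<le> 0}) \<and> x \<longlonglongrightarrow> l"
    have "(\<integral>\<^sup>+ \<omega>. ennreal (exp (l \<bullet> Y \<omega>)) \<partial>M)
        = (\<integral>\<^sup>+ \<omega>. liminf (\<lambda>n. ennreal (exp (x n \<bullet> Y \<omega>))) \<partial>M)"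
    proof (rule nn_integral_cong)
      fix \<omega>
      have "(\<lambda>n. ennreal (exp (x n \<bullet> Y \<omega>))) \<longlonglongrightarrow> ennreal (exp (l \<bullet> Y \<omega>))"
        using x by (intro tendsto_ennrealI tendsto_intros) auto
      then show "ennreal (exp (l \<bullet> Y \<omega>)) = liminf (\<lambda>n. ennreal (exp (x n \<bullet> Y \<omega>)))"
        by (intro lim_imp_Liminf[symmetric]) auto
    qed
    also have "\<dots> \<le> liminf (\<lambda>n. \<integral>\<^sup>+ \<omega>. ennreal (exp (x n \<bullet> Y \<omega>)) \<partial>M)"
      by (rule nn_integral_liminf) measurable
    also have "\<dots> \<le> 1"
    proof (rule Liminf_le)
      show "\<forall>\<^sub>F n in sequentially. (\<integral>\<^sup>+ \<omega>. ennreal (exp (x n \<bullet> Y \<omega>)) \<partial>M) \<le> 1"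
        using x unfolding eq by (intro always_eventually) blast
    qed simp
    finally show "l \<in> {\<theta>. \<Lambda> \<theta> \<le> 0}" unfolding eq by simp
  qed
qed

end

subsection \<open>Duality for the rates\<close>

lemma G_one_subset_G_minus: "G_one J \<subseteq> G_minus J"
proof
  fix A assume "A \<in> G_one J"
  then obtain k k' where k: "k \<in> J" "k' \<notin> J" "A = (J - {k}) \<union> {k'}" by (auto simp: G_one_def)
  then have "card A = card J"
    using card_Suc_Diff1[of J k] by simp
  then show "A \<in> G_minus J" using k by (auto simp: G_minus_def G_all_def)
qed

lemma G_minus_card_diff:
  assumes "A \<in> G_minus J"
  shows "card (A - J) = card (J - A)" "A - J \<noteq> {}" "J - A \<noteq> {}"
proof -
  have c: "card A = card J" "A \<noteq> J" using assms by (auto simp: G_minus_def G_all_def)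
  have "card (A - J) + card (A \<inter> J) = card A" "card (J - A) + card (A \<inter> J) = card J"
    by (metis card_Int_Diff finite add.commute Int_commute)+
  then show e: "card (A - J) = card (J - A)" using c by simp
  have "A - J = {} \<longleftrightarrow> J - A = {}" using e by (metis card_eq_0_iff finite)
  then show "A - J \<noteq> {}" "J - A \<noteq> {}" using c(2) by auto
qed

lemma G_one_if_card_le:
  assumes A: "A \<in> G_minus J" "card (A - J) \<le> 1"
  shows "A \<in> G_one J"
proof -
  have "card (A - J) = 1" using A G_minus_card_diff(2)[OF A(1)]
    by (metis card_0_eq finite le_neq_implies_less less_one)
  then obtain k k' where "A - J = {k'}" "J - A = {k}"
    using G_minus_card_diff(1)[OF A(1)] by (metis card_1_singletonE)
  then have "A = (J - {k}) \<union> {k'}" "k \<in> J" "k' \<notin> J" by auto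
  then show ?thesis by (auto simp: G_one_def)
qed

lemma obtain_two:
  assumes "\<not> card B \<le> 1"
  obtains x y where "x \<in> B" "y \<in> B" "x \<noteq> y"
proof -
  have "2 \<le> card B" using assms by simp
  then obtain T where "T \<subseteq> B" "card T = 2" by (meson obtain_subset_with_card_n)
  then show thesis using that by (auto simp: card_2_iff)
qed

text \<open>A set that is not a single swap of \<open>J\<close> differs from it in at least two
  coordinates on each side. These four coordinates make the four-variable program feasible within
  \<open>block_cone A\<close>.\<close>

lemma G_minus_far:
  assumes A: "A \<in> G_minus J" "A \<notin> G_one J"
  obtains l1 l2 l1' l2' where "(l1, l2, l1', l2') \<in> quads J" "l1 \<notin> A" "l2 \<notin> A" "l1' \<in> A" "l2' \<in> A"
proof -
  have c': "\<not> card (A - J) \<le> 1" using A G_one_if_card_le by blast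
  have c: "\<not> card (J - A) \<le> 1" using c' G_minus_card_diff(1)[OF A(1)] by simp
  obtain l1 l2 where "l1 \<in> J - A" "l2 \<in> J - A" "l1 \<noteq> l2"
    by (rule obtain_two[OF c], rule that)
  moreover obtain l1' l2' where "l1' \<in> A - J" "l2' \<in> A - J" "l1' \<noteq> l2'"
    by (rule obtain_two[OF c'], rule that)
  ultimately show thesis by (intro that[of l1 l2 l1' l2']) (auto simp: quads_def)
qed

text \<open>The double swap attaches to every quadruple some set of \<open>G_minus J\<close>, so
  that facts about \<open>feas\<close> carry over to the programs of \<open>quads J\<close> when no
  \<open>A\<close> is given.\<close>

lemma quads_swap:
  assumes "(l1, l2, l1', l2') \<in> quads J"
  defines "A \<equiv> (J - {l1, l2}) \<union> {l1', l2'}"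
  shows "A \<in> G_minus J" "l1 \<notin> A" "l2 \<notin> A" "l1' \<in> A" "l2' \<in> A"
proof -
  have q: "l1 \<in> J" "l2 \<in> J" "l1 \<noteq> l2" "l1' \<notin> J" "l2' \<notin> J" "l1' \<noteq> l2'"
    using assms by (auto simp: quads_def)
  have "card {l1, l2} \<le> card J" using q by (intro card_mono) auto
  moreover have "card A = card (J - {l1, l2}) + card {l1', l2'}"
    unfolding A_def using q by (intro card_Un_disjoint) auto
  ultimately have "card A = card J" using q by (simp add: card_Diff_subset)
  then show "A \<in> G_minus J" using q by (auto simp: G_minus_def G_all_def A_def)
  show "l1 \<notin> A" "l2 \<notin> A" "l1' \<in> A" "l2' \<in> A" using q by (auto simp: A_def)
qed

text \<open>The choice made by \<open>arg_max_on\<close> is meaningful only if the maximum is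
  attained, which compactness guarantees. The supremum in \<open>ereal\<close> is then the value at
  the chosen point.\<close>

lemma arg_max_on_compact:
  fixes f :: "'b::topological_space \<Rightarrow> real"
  assumes "compact F" "F \<noteq> {}" "continuous_on F f"
  shows "arg_max_on f F \<in> F" "(SUP x\<in>F. ereal (f x)) = ereal (f (arg_max_on f F))"
proof -
  obtain x where x: "x \<in> F" "\<forall>y\<in>F. f y \<le> f x"
    using continuous_attains_sup[OF assms] by blast
  then have "is_arg_max f (\<lambda>x. x \<in> F) x" by (auto simp: is_arg_max_def not_less)
  then have a: "is_arg_max f (\<lambda>x. x \<in> F) (arg_max_on f F)"
    unfolding arg_max_on_def arg_max_def by (rule someI)
  then show 1: "arg_max_on f F \<in> F" by (simp add: is_arg_max_def)
  show "(SUP x\<in>F. ereal (f x)) = ereal (f (arg_max_on f F))"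
    using a 1 by (intro antisym SUP_least SUP_upper) (auto simp: is_arg_max_def not_less)
qed

section \<open>Nondegeneracy and compactness under the gap rule\<close>

locale gap_rule = step_vector M Y
  for M :: "'a measure" and Y :: "'a \<Rightarrow> real ^ 'n::finite" +
  fixes J :: "'n set"
  assumes card_J: "2 \<le> card J" "card J + 2 \<le> CARD('n)"
    and mean_pos: "k \<in> J \<Longrightarrow> 0 < (\<integral>\<omega>. Y \<omega> $ k \<partial>M)"
    and mean_neg: "k \<notin> J \<Longrightarrow> (\<integral>\<omega>. Y \<omega> $ k \<partial>M) < 0"
    and cone_meets_W: "A \<in> G_minus J \<Longrightarrow> interior (open_cone (edom (conjugate \<Lambda>))) \<inter> W A \<noteq> {}"
begin

lemma G_one_nonempty: "G_one J \<noteq> {}"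
proof -
  have "J \<noteq> {}" "J \<noteq> UNIV" using card_J by auto
  then show ?thesis by (auto simp: G_one_def)
qed

lemma G_minus_proper:
  assumes "A \<in> G_minus J" shows "A \<noteq> UNIV"
  using assms card_J by (auto simp: G_minus_def G_all_def)

text \<open>By the definition of the conjugate, \<open>\<theta> \<bullet> y\<close> is at most its
  value at \<open>y\<close> plus \<open>\<Lambda> \<theta>\<close>, and the latter is nonpositive on
  the sublevel set. Scaling extends the bound to the cone.\<close>

lemma conjugate_bound:
  assumes "x \<in> open_cone (edom (conjugate \<Lambda>))"
  obtains R where "\<And>\<theta>. \<Lambda> \<theta> \<le> 0 \<Longrightarrow> \<theta> \<bullet> x \<le> R"
proof -
  obtain c y where x: "x = c *\<^sub>R y" "0 < c" "conjugate \<Lambda> y < \<infinity>"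
    using assms by (auto simp: open_cone_def edom_def)
  then obtain R where R: "conjugate \<Lambda> y \<le> ereal R"
    by (cases "conjugate \<Lambda> y") auto
  have "\<theta> \<bullet> x \<le> c * R" if "\<Lambda> \<theta> \<le> 0" for \<theta>
  proof -
    have \<theta>: "\<theta> \<in> edom \<Lambda>" using that by (simp add: cgf_le_0_iff)
    have "ereal (\<theta> \<bullet> y) - \<Lambda> \<theta> \<le> conjugate \<Lambda> y"
      unfolding conjugate_def by (rule SUP_upper) simp
    also note R
    finally have "\<theta> \<bullet> y - ln (mgf \<theta>) \<le> R" using cgf_eq[OF \<theta>] by simp
    moreover have "ln (mgf \<theta>) \<le> 0" using that cgf_eq[OF \<theta>] by simp
    ultimately have "\<theta> \<bullet> y \<le> R" by simp
    then show ?thesis using x by (simp add: mult_left_mono)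
  qed
  then show thesis using that by blast
qed

text \<open>If \<open>u \<bullet> Y\<close> vanished almost surely, the whole line through
  \<open>u\<close> would lie in the sublevel set of \<Lambda>. By \<open>conjugate_bound\<close>,
  \<open>u\<close> would then be orthogonal to a cone with nonempty interior.\<close>

lemma nondegenerate:
  assumes "AE \<omega> in M. u \<bullet> Y \<omega> = 0" shows "u = 0"
proof (rule ccontr)
  assume u: "u \<noteq> 0"
  let ?K = "open_cone (edom (conjugate \<Lambda>))"
  have zero: "u \<bullet> x = 0" if "x \<in> ?K" for x
  proof (rule ccontr)
    assume n: "u \<bullet> x \<noteq> 0"
    obtain R where R: "\<And>\<theta>. \<Lambda> \<theta> \<le> 0 \<Longrightarrow> \<theta> \<bullet> x \<le> R"
      using conjugate_bound[OF \<open>x \<in> ?K\<close>] by blast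
    have "\<Lambda> (s *\<^sub>R u) \<le> 0" for s
    proof -
      have ae: "AE \<omega> in M. exp ((s *\<^sub>R u) \<bullet> Y \<omega>) = 1" using assms by eventually_elim simp
      have "integrable M (\<lambda>\<omega>. exp ((s *\<^sub>R u) \<bullet> Y \<omega>)) = integrable M (\<lambda>\<omega>. 1::real)"
        using ae by (intro integrable_cong_AE) auto
      moreover have "mgf (s *\<^sub>R u) = (\<integral>\<omega>. 1 \<partial>M)"
        unfolding mgf_def using ae by (intro integral_cong_AE) auto
      ultimately show ?thesis by (simp add: cgf_le_0_iff edom_iff prob_space)
    qed
    \<comment> \<open>The multiple of \<open>u\<close> whose inner product with \<open>x\<close> is
      \<open>R + 1\<close>.\<close>
    from R[OF this, of "(R + 1) / (u \<bullet> x)"] n show False by simp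
  qed
  obtain p where "p \<in> interior ?K"
    using G_one_nonempty G_one_subset_G_minus cone_meets_W by blast
  then obtain e where e: "0 < e" "ball p e \<subseteq> ?K" by (auto simp: mem_interior)
  have "p \<in> ball p e" "p + (e / (2 * norm u)) *\<^sub>R u \<in> ball p e"
    using e u by (auto simp: dist_norm)
  then have "u \<bullet> p = 0" "u \<bullet> (p + (e / (2 * norm u)) *\<^sub>R u) = 0"
    using e zero by blast+
  then show False using e u by (simp add: inner_add_right)
qed

text \<open>The feasible set of the dual problem: the maximum of \<open>mass A\<close> over it turns
  out to be the rate of \<open>W A\<close>.\<close>

definition feas :: "'n set \<Rightarrow> (real ^ 'n) set" where
  "feas A = {\<theta>. \<Lambda> \<theta> \<le> 0} \<inter> block_cone A"

lemma feasD:
  assumes "\<theta> \<in> feas A"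
  shows "\<theta> \<in> edom \<Lambda>" "mgf \<theta> \<le> 1" "\<Lambda> \<theta> \<le> 0" "\<theta> \<in> block_cone A"
  using assms by (auto simp: feas_def cgf_le_0_iff)

lemma feas_inner_ge:
  assumes "A \<in> G_minus J" "\<theta> \<in> feas A" "x \<in> W A"
  shows "mass A \<theta> \<le> \<theta> \<bullet> x"
  using block_cone_inner_ge[of \<theta> A 1 x] feasD(4)[OF assms(2)] G_minus_proper[OF assms(1)] assms(3)
  by (force simp: W_def less_imp_le)

text \<open>The standing assumption supplies a point \<open>x\<close> of \<open>W A\<close> in the
  cone, and \<open>mass A \<theta> \<le> \<theta> \<bullet> x \<le> R\<close> for every feasible
  \<theta>. On the block cone the mass bounds the norm.\<close>

lemma compact_feas:
  assumes A: "A \<in> G_minus J" shows "compact (feas A)"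
proof -
  obtain x where x: "x \<in> W A" "x \<in> open_cone (edom (conjugate \<Lambda>))"
    using cone_meets_W[OF A] interior_subset by blast
  obtain R where R: "\<And>\<theta>. \<Lambda> \<theta> \<le> 0 \<Longrightarrow> \<theta> \<bullet> x \<le> R"
    using conjugate_bound[OF x(2)] by blast
  have "norm \<theta> \<le> 2 * R" if "\<theta> \<in> feas A" for \<theta>
    using block_cone_norm_le[OF feasD(4)[OF that]] feas_inner_ge[OF A that x(1)] R[OF feasD(3)[OF that]]
    by linarith
  then have "bounded (feas A)" by (auto simp: bounded_iff)
  moreover have "closed (feas A)"
    unfolding feas_def by (intro closed_Int closed_sublevel closed_block_cone)
  ultimately show ?thesis by (simp add: compact_eq_bounded_closed)
qed

lemma zero_in_feas: "0 \<in> feas A"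
  by (simp add: feas_def cgf_0 block_cone_def)

section \<open>First-order conditions at a maximizer and strong duality\<close>

definition optimal :: "'n set \<Rightarrow> real ^ 'n \<Rightarrow> bool" where
  "optimal A \<beta> \<longleftrightarrow> \<beta> \<in> feas A \<and> (\<forall>\<theta>\<in>feas A. mass A \<theta> \<le> mass A \<beta>)"

lemma optimal_exists:
  assumes "A \<in> G_minus J" shows "\<exists>\<beta>. optimal A \<beta>"
proof -
  have "continuous_on (feas A) (mass A)"
    unfolding mass_def[abs_def] by (intro continuous_intros)
  then show ?thesis
    unfolding optimal_def
    using continuous_attains_sup[OF compact_feas[OF assms], of "mass A"] zero_in_feas by blast
qed

context
  fixes A \<beta>
  assumes A: "A \<in> G_minus J" and opt: "optimal A \<beta>"
begin

lemma opt_feas: "\<beta> \<in> feas A" and opt_max: "\<theta> \<in> feas A \<Longrightarrow> mass A \<theta> \<le> mass A \<beta>"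
  using opt by (auto simp: optimal_def)

text \<open>For \<open>k\<close> in \<open>A - J\<close> and \<open>k'\<close> in
  \<open>J - A\<close> the mean of \<open>Y $ k - Y $ k'\<close> is negative, so \<open>mgf\<close>
  drops below 1 along the corresponding swap from 0. A short step in this direction is feasible with
  positive mass.\<close>

lemma opt_mass_pos: "0 < mass A \<beta>"
proof -
  obtain k k' where k: "k \<in> A" "k \<notin> J" "k' \<in> J" "k' \<notin> A"
    using G_minus_card_diff(2,3)[OF A] by blast
  have "swap_dir k k' \<bullet> tmean 0 < 0"
    using mean_pos[OF k(3)] mean_neg[OF k(2)] by (simp add: tmean_def)
  then obtain t where t: "0 < t" "t *\<^sub>R swap_dir k k' \<in> edom \<Lambda>" "mgf (t *\<^sub>R swap_dir k k') < 1"
    using mgf_decreasing_direction[OF mgf_0(2), of "swap_dir k k'"]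
    by (metis add_0 mgf_0(1) order_refl)
  have "t *\<^sub>R swap_dir k k' \<in> feas A"
    using t block_cone_scale[OF swap_dir_in_block_cone(1)[OF k(1,4)], of t]
    by (simp add: feas_def cgf_le_0_iff)
  from opt_max[OF this] show ?thesis
    using t swap_dir_in_block_cone(2)[OF k(1,4)] by (simp add: mass_scale)
qed

text \<open>With a slack constraint, \<beta> could be lengthened slightly along its own ray, which
  would increase its positive mass.\<close>

lemma opt_mgf: "mgf \<beta> = 1"
proof (rule ccontr)
  assume "mgf \<beta> \<noteq> 1"
  then have l: "mgf \<beta> < 1" using feasD(2)[OF opt_feas] by simp
  obtain \<eta> C where \<eta>: "0 < \<eta>" "0 \<le> C"
    "\<And>t. \<bar>t\<bar> \<le> \<eta> \<Longrightarrow> \<beta> + t *\<^sub>R \<beta> \<in> edom \<Lambda>"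
    "\<And>t. \<bar>t\<bar> \<le> \<eta> \<Longrightarrow> mgf (\<beta> + t *\<^sub>R \<beta>) \<le> mgf \<beta> + t * (\<beta> \<bullet> tmean \<beta>) + C * t\<^sup>2"
    by (rule mgf_direction[OF feasD(1)[OF opt_feas], of \<beta>], rule that)
  define D where "D = \<bar>\<beta> \<bullet> tmean \<beta>\<bar> + C + 1"
  \<comment> \<open>The bound 1 turns \<open>C * t\<^sup>2\<close> into at most
    \<open>C * t\<close>; the last bound keeps the total increase of \<open>mgf\<close> within the
    slack \<open>1 - mgf \<beta>\<close>.\<close>
  define t where "t = Min {\<eta>, 1, (1 - mgf \<beta>) / D}"
  have D: "0 < D" using \<eta> by (simp add: D_def)
  have t: "0 < t" "t \<le> \<eta>" "t \<le> 1" "t \<le> (1 - mgf \<beta>) / D"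
    using \<eta> l D by (auto simp: t_def)
  have "t * (\<beta> \<bullet> tmean \<beta>) + C * t\<^sup>2 \<le> t * \<bar>\<beta> \<bullet> tmean \<beta>\<bar> + t * C"
    using t \<eta>(2) by (intro add_mono mult_left_mono)
      (auto simp: power2_eq_square mult.commute mult.left_commute mult_left_le intro!: mult_left_mono)
  also have "\<dots> \<le> t * D" using t by (simp add: D_def algebra_simps)
  also have "\<dots> \<le> 1 - mgf \<beta>" using t(4) D by (simp add: pos_le_divide_eq)
  finally have "mgf (\<beta> + t *\<^sub>R \<beta>) \<le> 1" using \<eta>(4)[of t] t by simp
  then have "\<beta> + t *\<^sub>R \<beta> \<in> feas A"
    using \<eta>(3)[of t] t block_cone_add[OF feasD(4)[OF opt_feas] block_cone_scale[OF feasD(4)[OF opt_feas], of t]]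
    by (simp add: feas_def cgf_le_0_iff)
  from opt_max[OF this] show False
    using t opt_mass_pos by (simp add: mass_add mass_scale mult_le_0_iff)
qed

text \<open>\<open>mgf\<close> equals 1 at both \<beta> and 0, so the gradient inequality gives the
  weak sign. Equality would force \<beta> = 0 by nondegeneracy, against the positive mass.\<close>

lemma opt_inner_pos: "0 < \<beta> \<bullet> tmean \<beta>"
proof -
  note g = mgf_gradient_ineq[OF feasD(1)[OF opt_feas] mgf_0(2)]
  have "\<beta> \<bullet> tmean \<beta> \<noteq> 0"
  proof
    assume "\<beta> \<bullet> tmean \<beta> = 0"
    then have "AE \<omega> in M. (0 - \<beta>) \<bullet> Y \<omega> = 0" by (intro g(2)) (simp add: opt_mgf mgf_0)
    then have "\<beta> = 0" using nondegenerate by fastforce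
    then show False using opt_mass_pos by (simp add: mass_def)
  qed
  then show ?thesis using g(1) by (simp add: opt_mgf mgf_0)
qed

text \<open>A short step from \<beta> towards \<theta> lowers \<open>mgf\<close> and stays in the
  convex cone, hence is feasible, and the mass is linear. Thus \<beta> remains optimal when the
  constraint on \<Lambda> is replaced by its linearization.\<close>

lemma opt_dual:
  assumes \<theta>: "\<theta> \<in> block_cone A" and less: "\<theta> \<bullet> tmean \<beta> < \<beta> \<bullet> tmean \<beta>"
  shows "mass A \<theta> \<le> mass A \<beta>"
proof -
  have "(\<theta> - \<beta>) \<bullet> tmean \<beta> < 0" using less by (simp add: inner_diff_left)
  then obtain t0 where t0: "0 < t0"
    "\<And>t. 0 < t \<Longrightarrow> t \<le> t0 \<Longrightarrow> \<beta> + t *\<^sub>R (\<theta> - \<beta>) \<in> edom \<Lambda> \<and> mgf (\<beta> + t *\<^sub>R (\<theta> - \<beta>)) < mgf \<beta>"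
    using mgf_decreasing_direction[OF feasD(1)[OF opt_feas]] by blast
  define t where "t = min t0 1"
  have t: "0 < t" "t \<le> t0" "t \<le> 1" using t0 by (auto simp: t_def)
  have eq: "\<beta> + t *\<^sub>R (\<theta> - \<beta>) = (1 - t) *\<^sub>R \<beta> + t *\<^sub>R \<theta>" by (simp add: algebra_simps)
  have "\<beta> + t *\<^sub>R (\<theta> - \<beta>) \<in> feas A"
    using t t0(2)[OF t(1,2)] block_cone_add[OF block_cone_scale[OF feasD(4)[OF opt_feas], of "1 - t"] block_cone_scale[OF \<theta>, of t]]
    by (simp add: feas_def cgf_le_0_iff opt_mgf eq)
  from opt_max[OF this] have "t * mass A \<theta> \<le> t * mass A \<beta>"
    unfolding eq mass_add mass_scale by (simp add: algebra_simps)
  then show ?thesis using t by simp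
qed

text \<open>Linearized optimality is tested on multiples of one swap. If the inequality failed, a
  multiple slightly larger than \<open>mass A \<beta>\<close> would still satisfy the linear
  constraint strictly.\<close>

lemma opt_gap:
  assumes k: "k \<in> A" "k' \<notin> A"
  shows "\<beta> \<bullet> tmean \<beta> \<le> mass A \<beta> * (tmean \<beta> $ k - tmean \<beta> $ k')"
proof (rule ccontr)
  assume n: "\<not> ?thesis"
  define a where "a = tmean \<beta> $ k - tmean \<beta> $ k'"
  \<comment> \<open>The increment over \<open>mass A \<beta>\<close> uses up less than the available
    slack in \<open>c * a\<close>; the denominator \<open>\<bar>a\<bar> + 1\<close> handles every
    sign of \<open>a\<close>, including \<open>a = 0\<close>.\<close>
  define c where "c = mass A \<beta> + (\<beta> \<bullet> tmean \<beta> - mass A \<beta> * a) / (\<bar>a\<bar> + 1)"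
  have a: "mass A \<beta> * a < \<beta> \<bullet> tmean \<beta>" using n by (simp add: a_def)
  then have c: "mass A \<beta> < c" by (simp add: c_def)
  have "(\<beta> \<bullet> tmean \<beta> - mass A \<beta> * a) / (\<bar>a\<bar> + 1) * a \<le> (\<beta> \<bullet> tmean \<beta> - mass A \<beta> * a) / (\<bar>a\<bar> + 1) * \<bar>a\<bar>"
    using a by (intro mult_left_mono) auto
  also have "\<dots> < (\<beta> \<bullet> tmean \<beta> - mass A \<beta> * a) / (\<bar>a\<bar> + 1) * (\<bar>a\<bar> + 1)"
    using a by (intro mult_strict_left_mono) auto
  also have "\<dots> = \<beta> \<bullet> tmean \<beta> - mass A \<beta> * a" by simp
  finally have "c * a < \<beta> \<bullet> tmean \<beta>" by (simp add: c_def algebra_simps)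
  moreover have "c *\<^sub>R swap_dir k k' \<in> block_cone A"
    using swap_dir_in_block_cone(1)[OF k] c opt_mass_pos by (intro block_cone_scale) auto
  ultimately have "mass A (c *\<^sub>R swap_dir k k') \<le> mass A \<beta>"
    by (intro opt_dual) (simp_all add: a_def)
  then show False using c swap_dir_in_block_cone(2)[OF k] by (simp add: mass_scale)
qed

text \<open>The primal optimizer: the tilted mean rescaled so that its inner product with \<beta> is
  \<open>mass A \<beta>\<close>. It need only lie in the closure of \<open>W A\<close>.\<close>

definition opt_point :: "real ^ 'n" where
  "opt_point = (mass A \<beta> / (\<beta> \<bullet> tmean \<beta>)) *\<^sub>R tmean \<beta>"

lemma opt_point_gap:
  assumes "k \<in> A" "k' \<notin> A" shows "1 \<le> opt_point $ k - opt_point $ k'"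
proof -
  have "1 \<le> mass A \<beta> * (tmean \<beta> $ k - tmean \<beta> $ k') / (\<beta> \<bullet> tmean \<beta>)"
    using opt_gap[OF assms] opt_inner_pos by (simp only: pos_le_divide_eq mult_1)
  then show ?thesis by (simp add: opt_point_def right_diff_distrib diff_divide_distrib)
qed

text \<open>The tangent hyperplane at \<beta> supports the sublevel set, so \<beta> attains the rate
  at all nonnegative multiples of the tilted mean.\<close>

lemma sublevel_inner_le:
  assumes "\<Lambda> \<theta> \<le> 0" shows "\<theta> \<bullet> tmean \<beta> \<le> \<beta> \<bullet> tmean \<beta>"
  using mgf_gradient_ineq(1)[OF feasD(1)[OF opt_feas], of \<theta>] assms
  by (simp add: cgf_le_0_iff opt_mgf inner_diff_left)

lemma scaled_opt_point_in_W: "1 < c \<Longrightarrow> c *\<^sub>R opt_point \<in> W A"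
proof -
  assume c: "1 < c"
  have "1 < c * (opt_point $ k - opt_point $ k')" if "k \<in> A" "k' \<notin> A" for k k'
    using c mult_mono[OF less_imp_le[OF c] opt_point_gap[OF that]] mult_left_mono[OF opt_point_gap[OF that], of c]
    by linarith
  then show ?thesis by (auto simp: W_def right_diff_distrib)
qed

lemma rate_opt_point_le:
  assumes "0 \<le> c" shows "rate_fn \<Lambda> (c *\<^sub>R opt_point) \<le> ereal (c * mass A \<beta>)"
  unfolding rate_fn_def
proof (rule SUP_least)
  fix \<theta> assume "\<theta> \<in> {\<theta>. \<Lambda> \<theta> \<le> 0}"
  then have "\<theta> \<bullet> tmean \<beta> \<le> \<beta> \<bullet> tmean \<beta>" using sublevel_inner_le by simp
  then have "(mass A \<beta> / (\<beta> \<bullet> tmean \<beta>)) * (\<theta> \<bullet> tmean \<beta>) \<le> (mass A \<beta> / (\<beta> \<bullet> tmean \<beta>)) * (\<beta> \<bullet> tmean \<beta>)"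
    using opt_mass_pos opt_inner_pos by (intro mult_left_mono) auto
  then have "\<theta> \<bullet> opt_point \<le> mass A \<beta>"
    using opt_inner_pos by (simp add: opt_point_def)
  then show "ereal (\<theta> \<bullet> c *\<^sub>R opt_point) \<le> ereal (c * mass A \<beta>)"
    using assms by (simp add: mult_left_mono)
qed

text \<open>Weak duality: every point of \<open>W A\<close> has inner product at least
  \<open>mass A \<beta>\<close> with the feasible \<beta>. Conversely, \<open>opt_point\<close>
  scaled by \<open>c > 1\<close> enters the open set \<open>W A\<close> at rate at most
  \<open>c * mass A \<beta>\<close>, and \<open>c\<close> may be taken arbitrarily close to
  1.\<close>

lemma r_set_eq: "r_set \<Lambda> A = ereal (mass A \<beta>)"
proof (rule antisym)
  show "r_set \<Lambda> A \<le> ereal (mass A \<beta>)"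
  proof (rule ccontr)
    assume "\<not> ?thesis"
    then have "ereal (mass A \<beta>) < r_set \<Lambda> A" by simp
    from ereal_dense2[OF this] obtain z where z: "mass A \<beta> < z" "ereal z < r_set \<Lambda> A" by auto
    define c where "c = z / mass A \<beta>"
    have c: "1 < c" "c * mass A \<beta> = z" using z opt_mass_pos by (auto simp: c_def)
    have "r_set \<Lambda> A \<le> rate_fn \<Lambda> (c *\<^sub>R opt_point)"
      unfolding r_set_def by (intro INF_lower scaled_opt_point_in_W c)
    also have "\<dots> \<le> ereal z" using rate_opt_point_le[of c] c by simp
    finally show False using z by simp
  qed
  show "ereal (mass A \<beta>) \<le> r_set \<Lambda> A"
    unfolding r_set_def
  proof (rule INF_greatest)
    fix x assume x: "x \<in> W A"
    have "ereal (mass A \<beta>) \<le> ereal (\<beta> \<bullet> x)" using feas_inner_ge[OF A opt_feas x] by simp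
    also have "\<dots> \<le> rate_fn \<Lambda> x"
      unfolding rate_fn_def using feasD(3)[OF opt_feas] by (intro SUP_upper) simp
    finally show "ereal (mass A \<beta>) \<le> rate_fn \<Lambda> x" .
  qed
qed

text \<open>For uniqueness, the inclusion of \<open>W A\<close> is tested on multiples of
  \<open>opt_point\<close> close to the point itself. Together with the supporting hyperplane this
  gives equality in the gradient inequality between \<beta> and the competitor, and nondegeneracy
  identifies them.\<close>

lemma beta_eq: "beta \<Lambda> A = \<beta>"
  unfolding beta_def
proof (rule the_equality)
  have "ereal (\<beta> \<bullet> x) \<le> rate_fn \<Lambda> x" for x
    unfolding rate_fn_def using feasD(3)[OF opt_feas] by (intro SUP_upper) simp
  then have "{x. rate_fn \<Lambda> x \<le> r_set \<Lambda> A} \<subseteq> {v. ereal (\<beta> \<bullet> v) \<le> r_set \<Lambda> A}"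
    by (blast intro: order_trans)
  then show "\<Lambda> \<beta> = 0 \<and> W A \<subseteq> {v. ereal (\<beta> \<bullet> v) \<ge> r_set \<Lambda> A} \<and>
      {x. rate_fn \<Lambda> x \<le> r_set \<Lambda> A} \<subseteq> {v. ereal (\<beta> \<bullet> v) \<le> r_set \<Lambda> A}"
    using feas_inner_ge[OF A opt_feas] feasD(1)[OF opt_feas]
    by (auto simp: cgf_eq_0_iff opt_mgf r_set_eq)
next
  fix \<theta>
  assume \<theta>: "\<Lambda> \<theta> = 0 \<and> W A \<subseteq> {v. ereal (\<theta> \<bullet> v) \<ge> r_set \<Lambda> A} \<and>
      {x. rate_fn \<Lambda> x \<le> r_set \<Lambda> A} \<subseteq> {v. ereal (\<theta> \<bullet> v) \<le> r_set \<Lambda> A}"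
  then have W: "mass A \<beta> \<le> c * (\<theta> \<bullet> opt_point)" if "1 < c" for c
    using scaled_opt_point_in_W[OF that] by (auto simp: r_set_eq)
  have "mass A \<beta> \<le> \<theta> \<bullet> opt_point"
  proof (rule ccontr)
    assume n: "\<not> ?thesis"
    have pos: "0 < \<theta> \<bullet> opt_point" using W[of 2] opt_mass_pos by simp
    obtain z where z: "\<theta> \<bullet> opt_point < z" "z < mass A \<beta>"
      using dense[of "\<theta> \<bullet> opt_point" "mass A \<beta>"] n by auto
    \<comment> \<open>This factor exceeds 1 and scales the inner product to \<open>z\<close>, which
      is below \<open>mass A \<beta>\<close>.\<close>
    then show False using W[of "z / (\<theta> \<bullet> opt_point)"] pos by simp
  qed
  then have "\<beta> \<bullet> tmean \<beta> \<le> \<theta> \<bullet> tmean \<beta>"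
    using opt_inner_pos opt_mass_pos by (simp add: opt_point_def pos_le_divide_eq mult.commute)
  moreover have "\<theta> \<bullet> tmean \<beta> \<le> \<beta> \<bullet> tmean \<beta>" using \<theta> by (intro sublevel_inner_le) simp
  moreover have "\<theta> \<in> edom \<Lambda>" "mgf \<theta> = 1" using \<theta> by (auto simp: cgf_eq_0_iff)
  ultimately have "AE \<omega> in M. (\<theta> - \<beta>) \<bullet> Y \<omega> = 0"
    using feasD(1)[OF opt_feas] by (intro mgf_gradient_ineq(2)) (auto simp: opt_mgf inner_diff_left)
  then show "\<theta> = \<beta>" using nondegenerate by fastforce
qed

end

lemma beta_optimal: "A \<in> G_minus J \<Longrightarrow> optimal A (beta \<Lambda> A)"
  using optimal_exists beta_eq by metis

section \<open>The programs in two and four coordinates\<close>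

lemma feas4_in_feas:
  assumes q: "(l1, l2, l1', l2') \<in> quads J" and l: "l1 \<notin> A" "l2 \<notin> A" "l1' \<in> A" "l2' \<in> A"
    and \<theta>: "\<theta> \<in> feas4 \<Lambda> l1 l2 l1' l2'"
  shows "\<theta> \<in> feas A" "mass A \<theta> = \<theta> $ l1' + \<theta> $ l2'"
proof -
  have d: "l1 \<noteq> l2" "l1' \<noteq> l2'" using q by (auto simp: quads_def)
  have "mass A \<theta> = (\<Sum>k\<in>{l1', l2'}. \<theta> $ k)"
    unfolding mass_def using l \<theta> by (intro sum.mono_neutral_right) (auto simp: feas4_def)
  then show "mass A \<theta> = \<theta> $ l1' + \<theta> $ l2'" using d by simp
  have "(\<Sum>k\<in>UNIV. \<theta> $ k) = (\<Sum>k\<in>{l1, l2, l1', l2'}. \<theta> $ k)"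
    using \<theta> by (intro sum.mono_neutral_right) (auto simp: feas4_def)
  also have "\<dots> = \<theta> $ l1 + \<theta> $ l2 + \<theta> $ l1' + \<theta> $ l2'"
    using d l by (subst sum.insert, simp, force)+ simp
  finally have s: "(\<Sum>k\<in>UNIV. \<theta> $ k) = 0" using \<theta> by (simp add: feas4_def)
  have "0 \<le> \<theta> $ k" if "k \<in> A" for k
    using \<theta> l that by (cases "k \<in> {l1, l2, l1', l2'}") (auto simp: feas4_def)
  moreover have "\<theta> $ k \<le> 0" if "k \<notin> A" for k
    using \<theta> l that by (cases "k \<in> {l1, l2, l1', l2'}") (auto simp: feas4_def)
  ultimately show "\<theta> \<in> feas A" using \<theta> s by (auto simp: feas_def feas4_def block_cone_def)
qed

lemma feas2_subset_feas4:
  assumes q: "(l1, l2, l1', l2') \<in> quads J"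
  shows "feas2 \<Lambda> l1 l1' \<subseteq> feas4 \<Lambda> l1 l2 l1' l2'"
    and "\<theta> \<in> feas2 \<Lambda> l1 l1' \<Longrightarrow> \<theta> $ l2' = 0"
proof -
  have "l2 \<notin> {l1, l1'}" "l2' \<notin> {l1, l1'}" using q by (auto simp: quads_def)
  then show "feas2 \<Lambda> l1 l1' \<subseteq> feas4 \<Lambda> l1 l2 l1' l2'" "\<theta> \<in> feas2 \<Lambda> l1 l1' \<Longrightarrow> \<theta> $ l2' = 0"
    by (auto simp: feas2_def feas4_def)
qed

lemma compact_feas4:
  assumes q: "(l1, l2, l1', l2') \<in> quads J"
  shows "compact (feas4 \<Lambda> l1 l2 l1' l2')"
proof -
  define A where "A = (J - {l1, l2}) \<union> {l1', l2'}"
  note A = quads_swap[OF q, folded A_def]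
  have "feas4 \<Lambda> l1 l2 l1' l2' = feas A \<inter> ({\<theta>. \<theta> $ l1 + \<theta> $ l2 + \<theta> $ l1' + \<theta> $ l2' = 0}
      \<inter> {\<theta>. \<theta> $ l1 \<le> 0} \<inter> {\<theta>. \<theta> $ l2 \<le> 0} \<inter> {\<theta>. 0 \<le> \<theta> $ l1'} \<inter> {\<theta>. 0 \<le> \<theta> $ l2'}
      \<inter> (\<Inter>k\<in>-{l1, l2, l1', l2'}. {\<theta>. \<theta> $ k = 0}))"
    using feas4_in_feas(1)[OF q A(2-5)] by (auto simp: feas4_def feas_def)
  also have "compact \<dots>"
    by (intro compact_Int_closed compact_feas A(1) closed_Int closed_INT ballI closed_Collect_le
        closed_Collect_eq continuous_intros)
  finally show ?thesis .
qed

lemma compact_feas2: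
  assumes q: "(l1, l2, l1', l2') \<in> quads J"
  shows "compact (feas2 \<Lambda> l1 l1')"
proof -
  have "l1 \<noteq> l2" "l2 \<notin> {l1, l1'}" "l2' \<notin> {l1, l1'}" using q by (auto simp: quads_def)
  then have "feas2 \<Lambda> l1 l1' = feas4 \<Lambda> l1 l2 l1' l2' \<inter> ({\<theta>. \<theta> $ l2 = 0} \<inter> {\<theta>. \<theta> $ l2' = 0})"
    using feas2_subset_feas4[OF q] by (auto simp: feas4_def) (auto simp: feas2_def)
  also have "compact \<dots>"
    by (intro compact_Int_closed compact_feas4[OF q] closed_Int closed_Collect_eq continuous_intros)
  finally show ?thesis .
qed

lemma zero_in_feas24: "0 \<in> feas2 \<Lambda> l l'" "0 \<in> feas4 \<Lambda> l1 l2 l1' l2'"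
  by (auto simp: feas2_def feas4_def cgf_0)

text \<open>The vector does not depend on \<open>A\<close>: it is feasible for every
  \<open>A\<close> that contains \<open>l1'\<close>, \<open>l2'\<close> and misses
  \<open>l1\<close>, \<open>l2\<close>, and the objective of its program is its mass for each such
  \<open>A\<close>.\<close>

lemma gamma4_optimal:
  assumes q: "(l1, l2, l1', l2') \<in> quads J" and l: "l1 \<notin> A" "l2 \<notin> A" "l1' \<in> A" "l2' \<in> A"
  shows "gamma4 \<Lambda> l1 l2 l1' l2' \<in> feas A"
    and "s_val \<Lambda> l1 l2 l1' l2' = ereal (mass A (gamma4 \<Lambda> l1 l2 l1' l2'))"
proof -
  note a = arg_max_on_compact[OF compact_feas4[OF q], of "\<lambda>\<theta>. \<theta> $ l1' + \<theta> $ l2'", folded gamma4_def s_val_def]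
  have c: "continuous_on (feas4 \<Lambda> l1 l2 l1' l2') (\<lambda>\<theta>. \<theta> $ l1' + \<theta> $ l2')" by (intro continuous_intros)
  have g: "gamma4 \<Lambda> l1 l2 l1' l2' \<in> feas4 \<Lambda> l1 l2 l1' l2'" using a(1) c zero_in_feas24(2) by blast
  show "gamma4 \<Lambda> l1 l2 l1' l2' \<in> feas A" using feas4_in_feas(1)[OF q l g] .
  have "feas4 \<Lambda> l1 l2 l1' l2' \<noteq> {}" using zero_in_feas24(2) by blast
  then show "s_val \<Lambda> l1 l2 l1' l2' = ereal (mass A (gamma4 \<Lambda> l1 l2 l1' l2'))"
    using a(2) c feas4_in_feas(2)[OF q l g] by simp
qed

lemma gamma2_optimal:
  assumes q: "(l1, l2, l1', l2') \<in> quads J" and l: "l1 \<notin> A" "l2 \<notin> A" "l1' \<in> A" "l2' \<in> A"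
  shows "gamma2 \<Lambda> l1 l1' \<in> feas A"
    and "z_val \<Lambda> l1 l1' = ereal (mass A (gamma2 \<Lambda> l1 l1'))"
proof -
  note a = arg_max_on_compact[OF compact_feas2[OF q], of "\<lambda>\<theta>. \<theta> $ l1'", folded gamma2_def z_val_def]
  have c: "continuous_on (feas2 \<Lambda> l1 l1') (\<lambda>\<theta>. \<theta> $ l1')" by (intro continuous_intros)
  have g: "gamma2 \<Lambda> l1 l1' \<in> feas2 \<Lambda> l1 l1'" using a(1) c zero_in_feas24(1) by blast
  then have g4: "gamma2 \<Lambda> l1 l1' \<in> feas4 \<Lambda> l1 l2 l1' l2'" using feas2_subset_feas4(1)[OF q] by blast
  show "gamma2 \<Lambda> l1 l1' \<in> feas A" using feas4_in_feas(1)[OF q l g4] .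
  show "z_val \<Lambda> l1 l1' = ereal (mass A (gamma2 \<Lambda> l1 l1'))"
  proof -
    have "feas2 \<Lambda> l1 l1' \<noteq> {}" using zero_in_feas24(1) by blast
    then show ?thesis using a(2) c feas4_in_feas(2)[OF q l g4] feas2_subset_feas4(2)[OF q g] by simp
  qed
qed

end

subsection \<open>The second moment\<close>

lemma in_scaled_W_iff:
  assumes "0 < b"
  shows "y \<in> (\<lambda>x. b *\<^sub>R x) ` W A \<longleftrightarrow> (\<forall>k\<in>A. \<forall>k'\<in>- A. y $ k - y $ k' > b)"
proof
  assume "y \<in> (\<lambda>x. b *\<^sub>R x) ` W A"
  then show "\<forall>k\<in>A. \<forall>k'\<in>- A. y $ k - y $ k' > b"
    using assms by (auto simp: W_def right_diff_distrib[symmetric])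
next
  assume h: "\<forall>k\<in>A. \<forall>k'\<in>- A. y $ k - y $ k' > b"
  have "(1 / b) *\<^sub>R y \<in> W A"
    using assms h by (auto simp: W_def diff_divide_distrib[symmetric] pos_less_divide_eq)
  moreover have "y = b *\<^sub>R ((1 / b) *\<^sub>R y)" using assms by simp
  ultimately show "y \<in> (\<lambda>x. b *\<^sub>R x) ` W A" by blast
qed

lemma hit_le_iff: "hit X b A \<omega> \<le> enat n \<longleftrightarrow> (\<exists>i\<le>n. S X i \<omega> \<in> (\<lambda>x. b *\<^sub>R x) ` W A)"
proof -
  \<comment> \<open>A strict bound on an infimum unfolds to the existence of a smaller element, also
    when the infimum is over the empty set and equals infinity.\<close>
  have "hit X b A \<omega> \<le> enat n \<longleftrightarrow> hit X b A \<omega> < enat (Suc n)"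
    by (cases "hit X b A \<omega>") auto
  also have "\<dots> \<longleftrightarrow> (\<exists>i\<le>n. S X i \<omega> \<in> (\<lambda>x. b *\<^sub>R x) ` W A)"
    by (auto simp: hit_def Inf_less_iff less_Suc_eq_le)
  finally show ?thesis .
qed

lemma hit_star_le_iff:
  assumes "G_minus J \<noteq> {}"
  shows "hit_star X b J \<omega> \<le> enat n \<longleftrightarrow> (\<exists>A\<in>G_minus J. hit X b A \<omega> \<le> enat n)"
  using assms by (simp add: hit_star_def Min_le_iff)

section \<open>The natural filtration and changes of measure\<close>

locale tilted_walk = gap_rule M "X 1" J
  for M :: "'a measure" and X :: "nat \<Rightarrow> 'a \<Rightarrow> real ^ 'n::finite" and J :: "'n set" +
  fixes Q :: "real ^ 'n \<Rightarrow> 'a measure"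
  assumes X_measurable: "1 \<le> i \<Longrightarrow> X i \<in> borel_measurable M"
    and tilted: "\<theta> \<in> edom \<Lambda> \<Longrightarrow> tilted M X \<theta> (Q \<theta>)"
begin

text \<open>The family \<open>filt M X n\<close> packaged as a measure space, so that the
  measurability of functions of the first \<open>n\<close> steps can be expressed.\<close>

definition past :: "nat \<Rightarrow> 'a measure" where
  "past n = sigma (space M) {X i -` B \<inter> space M | i B. i \<in> {1..n} \<and> B \<in> sets borel}"

lemma space_past [simp]: "space (past n) = space M"
  unfolding past_def by (intro space_measure_of) auto

lemma sets_past: "sets (past n) = filt M X n"
  unfolding past_def filt_def by (intro sets_measure_of) auto

lemma subalgebra_past: "subalgebra M (past n)"
proof -
  have "filt M X n \<subseteq> sets M"
    unfolding filt_def by (intro sets.sigma_sets_subset) (auto intro: measurable_sets[OF X_measurable])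
  then show ?thesis by (simp add: subalgebra_def sets_past)
qed

lemma measurable_past: "f \<in> measurable (past n) N \<Longrightarrow> f \<in> measurable M N"
  using measurable_from_subalg[OF subalgebra_past] .

lemma X_past: "1 \<le> i \<Longrightarrow> i \<le> n \<Longrightarrow> X i \<in> borel_measurable (past n)"
proof (rule measurableI)
  fix B :: "(real ^ 'n) set" assume "1 \<le> i" "i \<le> n" "B \<in> sets borel"
  then show "X i -` B \<inter> space (past n) \<in> sets (past n)"
    unfolding sets_past filt_def space_past by (intro sigma_sets.Basic) auto
qed simp

lemma S_past: "i \<le> n \<Longrightarrow> S X i \<in> borel_measurable (past n)"
  unfolding S_def[abs_def] by (intro borel_measurable_sum X_past) auto

lemma S_past_self [measurable]: "S X n \<in> borel_measurable (past n)"
  by (rule S_past) simp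

lemma lik_past [measurable]: "lik M X \<theta> n \<in> borel_measurable (past n)"
  unfolding lik_def[abs_def] by measurable

lemma lik_pos: "0 < lik M X \<theta> n \<omega>" by (simp add: lik_def)

text \<open>The density is known only on \<open>filt M X n\<close>, so both measures are restricted
  to this sub-algebra. Integrals of functions measurable there are unchanged by the
  restriction.\<close>

lemma change_of_measure:
  assumes P: "sets P = sets M" and g: "g \<in> borel_measurable (past n)"
    and eq: "\<And>E. E \<in> filt M X n \<Longrightarrow> emeasure P E = (\<integral>\<^sup>+ \<omega>\<in>E. g \<omega> \<partial>M)"
    and f: "f \<in> borel_measurable (past n)"
  shows "(\<integral>\<^sup>+ \<omega>. f \<omega> \<partial>P) = (\<integral>\<^sup>+ \<omega>. g \<omega> * f \<omega> \<partial>M)"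
proof -
  have sp: "space P = space M" using P by (rule sets_eq_imp_space_eq)
  have sP: "subalgebra P (past n)" using subalgebra_past P sp by (simp add: subalgebra_def)
  have restr: "restr_to_subalg P (past n) = density (restr_to_subalg M (past n)) g"
  proof (rule measure_eqI)
    show "sets (restr_to_subalg P (past n)) = sets (density (restr_to_subalg M (past n)) g)"
      by (simp add: sets_restr_to_subalg[OF sP] sets_restr_to_subalg[OF subalgebra_past])
    fix E assume "E \<in> sets (restr_to_subalg P (past n))"
    then have E: "E \<in> sets (past n)" by (simp add: sets_restr_to_subalg[OF sP])
    have gm: "g \<in> borel_measurable (restr_to_subalg M (past n))"
      using g by (rule measurable_in_subalg[OF subalgebra_past])
    have "emeasure (density (restr_to_subalg M (past n)) g) E
        = (\<integral>\<^sup>+ \<omega>. g \<omega> * indicator E \<omega> \<partial>restr_to_subalg M (past n))"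
      using E gm by (intro emeasure_density) (auto simp: sets_restr_to_subalg[OF subalgebra_past])
    also have "\<dots> = (\<integral>\<^sup>+ \<omega>. g \<omega> * indicator E \<omega> \<partial>M)"
      using E g by (intro nn_integral_subalgebra2[OF subalgebra_past] borel_measurable_times_ennreal
          borel_measurable_indicator)
    also have "\<dots> = emeasure P E" using eq[of E] E by (simp add: sets_past)
    finally show "emeasure (restr_to_subalg P (past n)) E = emeasure (density (restr_to_subalg M (past n)) g) E"
      using E by (simp add: emeasure_restr_to_subalg[OF sP])
  qed
  have "(\<integral>\<^sup>+ \<omega>. f \<omega> \<partial>P) = (\<integral>\<^sup>+ \<omega>. f \<omega> \<partial>restr_to_subalg P (past n))"
    using f by (rule nn_integral_subalgebra2[OF sP, symmetric])
  also have "\<dots> = (\<integral>\<^sup>+ \<omega>. g \<omega> * f \<omega> \<partial>restr_to_subalg M (past n))"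
    unfolding restr using f g
    by (intro nn_integral_density measurable_in_subalg[OF subalgebra_past])
  also have "\<dots> = (\<integral>\<^sup>+ \<omega>. g \<omega> * f \<omega> \<partial>M)"
    using f g by (intro nn_integral_subalgebra2[OF subalgebra_past]) measurable
  finally show ?thesis .
qed

lemma Q_prob: "\<theta> \<in> edom \<Lambda> \<Longrightarrow> prob_space (Q \<theta>)"
  and Q_sets: "\<theta> \<in> edom \<Lambda> \<Longrightarrow> sets (Q \<theta>) = sets M"
  and Q_emeasure: "\<theta> \<in> edom \<Lambda> \<Longrightarrow> E \<in> sets (past n) \<Longrightarrow>
    emeasure (Q \<theta>) E = (\<integral>\<^sup>+ \<omega>. ennreal (lik M X \<theta> n \<omega>) * indicator E \<omega> \<partial>M)"
  using tilted[of \<theta>] by (auto simp: tilted_def sets_past)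

lemma nn_integral_lik:
  assumes "\<theta> \<in> edom \<Lambda>" shows "(\<integral>\<^sup>+ \<omega>. ennreal (lik M X \<theta> n \<omega>) \<partial>M) = 1"
proof -
  have "emeasure (Q \<theta>) (space M) = (\<integral>\<^sup>+ \<omega>. ennreal (lik M X \<theta> n \<omega>) * indicator (space M) \<omega> \<partial>M)"
    using Q_emeasure[OF assms, of "space M" n] sets.top[of "past n"] by simp
  moreover have "emeasure (Q \<theta>) (space M) = 1"
    using prob_space.emeasure_space_1[OF Q_prob[OF assms]] sets_eq_imp_space_eq[OF Q_sets[OF assms]] by simp
  ultimately show ?thesis by (simp cong: nn_integral_cong)
qed

lemma lik_eq: "\<theta> \<in> edom \<Lambda> \<Longrightarrow> lik M X \<theta> n \<omega> = exp (\<theta> \<bullet> S X n \<omega>) / mgf \<theta> ^ n"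
  using mgf_pos[of \<theta>] unfolding lik_def by (subst cgf_eq) (simp_all add: exp_diff exp_of_nat_mult)

text \<open>The likelihood integrates to 1 because \<open>Q \<theta>\<close> is a probability
  measure; its normalization is the factor \<open>mgf \<theta> ^ n\<close>.\<close>

lemma nn_integral_exp_S:
  assumes \<theta>: "\<theta> \<in> edom \<Lambda>"
  shows "(\<integral>\<^sup>+ \<omega>. ennreal (exp (\<theta> \<bullet> S X n \<omega>)) \<partial>M) = ennreal (mgf \<theta> ^ n)"
proof -
  note measurable_past[OF S_past_self, measurable]
  have p: "0 < mgf \<theta> ^ n" using mgf_pos[OF \<theta>] by simp
  have "(\<integral>\<^sup>+ \<omega>. ennreal (exp (\<theta> \<bullet> S X n \<omega>)) \<partial>M)
      = (\<integral>\<^sup>+ \<omega>. ennreal (mgf \<theta> ^ n) * ennreal (lik M X \<theta> n \<omega>) \<partial>M)"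
    using mgf_pos[OF \<theta>]
    by (intro nn_integral_cong) (simp add: lik_eq[OF \<theta>] ennreal_mult[symmetric] del: One_nat_def)
  also have "\<dots> = ennreal (mgf \<theta> ^ n)"
    using measurable_past[OF lik_past] by (simp add: nn_integral_cmult nn_integral_lik[OF \<theta>])
  finally show ?thesis .
qed

section \<open>The error event split by the stopping time\<close>

definition wrong :: "real \<Rightarrow> nat \<Rightarrow> 'a set" where
  "wrong b n = {\<omega> \<in> space M. hit_star X b J \<omega> = enat n \<and> enat n < hit X b J \<omega>}"

lemma G_minus_nonempty: "G_minus J \<noteq> {}"
  using G_one_nonempty G_one_subset_G_minus by blast

lemma pred_hit_le:
  assumes "0 < b" "i \<le> n"
  shows "Measurable.pred (past n) (\<lambda>\<omega>. hit X b A \<omega> \<le> enat i)"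
proof -
  have "(\<lambda>x. b *\<^sub>R x) ` W A \<in> sets (borel :: (real ^ 'n) measure)"
    using assms open_W by (intro borel_open open_scaling) auto
  then have "{\<omega> \<in> space (past n). S X j \<omega> \<in> (\<lambda>x. b *\<^sub>R x) ` W A} \<in> sets (past n)" if "j \<le> i" for j
    using measurable_sets[OF S_past, of j n] that assms by (auto simp: vimage_def Int_def conj_commute)
  then have "(\<Union>j\<in>{..i}. {\<omega> \<in> space (past n). S X j \<omega> \<in> (\<lambda>x. b *\<^sub>R x) ` W A}) \<in> sets (past n)"
    by (intro sets.finite_UN) auto
  also have "(\<Union>j\<in>{..i}. {\<omega> \<in> space (past n). S X j \<omega> \<in> (\<lambda>x. b *\<^sub>R x) ` W A})
      = {\<omega> \<in> space (past n). hit X b A \<omega> \<le> enat i}"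
    by (auto simp: hit_le_iff)
  finally show ?thesis by (simp add: pred_def)
qed

lemma wrong_past:
  assumes "0 < b" shows "wrong b n \<in> sets (past n)"
proof -
  have star: "Measurable.pred (past n) (\<lambda>\<omega>. hit_star X b J \<omega> \<le> enat i)" if "i \<le> n" for i
    unfolding hit_star_le_iff[OF G_minus_nonempty]
    by (intro pred_intros_finite pred_hit_le assms that) simp
  have eq: "hit_star X b J \<omega> = enat n \<longleftrightarrow>
      hit_star X b J \<omega> \<le> enat n \<and> (\<forall>i\<in>{..<n}. \<not> hit_star X b J \<omega> \<le> enat i)" for \<omega>
    by (cases "hit_star X b J \<omega>") (auto simp: not_le dest: leI)
  have "Measurable.pred (past n) (\<lambda>\<omega>. (hit_star X b J \<omega> \<le> enat n \<and>
      (\<forall>i\<in>{..<n}. \<not> hit_star X b J \<omega> \<le> enat i)) \<and> \<not> hit X b J \<omega> \<le> enat n)"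
    by (intro pred_intros_logic pred_intros_finite star pred_hit_le assms) auto
  then have "{\<omega> \<in> space (past n). (hit_star X b J \<omega> \<le> enat n \<and>
      (\<forall>i\<in>{..<n}. \<not> hit_star X b J \<omega> \<le> enat i)) \<and> \<not> hit X b J \<omega> \<le> enat n} \<in> sets (past n)"
    by (simp only: pred_def)
  then show ?thesis by (simp add: wrong_def eq not_le)
qed

lemma wrong_sets: "0 < b \<Longrightarrow> wrong b n \<in> sets M"
  using wrong_past subalgebra_past by (auto simp: subalgebra_def)

lemma wrong_disjoint: "\<omega> \<in> wrong b n \<Longrightarrow> \<omega> \<in> wrong b n' \<Longrightarrow> n = n'"
  by (simp add: wrong_def)

lemma err_event_eq: "{\<omega> \<in> space M. hit_star X b J \<omega> < hit X b J \<omega>} = (\<Union>n. wrong b n)"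
proof -
  have "\<exists>n. hit_star X b J \<omega> = enat n" if "hit_star X b J \<omega> < hit X b J \<omega>" for \<omega>
    using that by (cases "hit_star X b J \<omega>") auto
  then show ?thesis by (auto simp: wrong_def) metis
qed

text \<open>The stopping time is exactly \<open>n\<close>, so an entry at some time up to
  \<open>n\<close> cannot be earlier than \<open>n\<close>.\<close>

lemma wrong_hits:
  assumes "\<omega> \<in> wrong b n"
  obtains A where "A \<in> G_minus J" "S X n \<omega> \<in> (\<lambda>x. b *\<^sub>R x) ` W A"
proof -
  have h: "hit_star X b J \<omega> = enat n" using assms by (simp add: wrong_def)
  then obtain A i where A: "A \<in> G_minus J" "i \<le> n" "S X i \<omega> \<in> (\<lambda>x. b *\<^sub>R x) ` W A"
    using hit_star_le_iff[OF G_minus_nonempty, of X b \<omega> n] by (auto simp: hit_le_iff)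
  then have "hit_star X b J \<omega> \<le> enat i"
    using hit_star_le_iff[OF G_minus_nonempty, of X b \<omega> i] by (auto simp: hit_le_iff)
  then have "i = n" using h A(2) by simp
  then show thesis using A that by blast
qed

text \<open>The events \<open>wrong b n\<close> are disjoint and exhaust the error event, so a
  quantity read at the stopping time becomes a series. Its \<open>n\<close>-th term involves only
  the first \<open>n\<close> steps, where the change of measure applies.\<close>

lemma nn_integral_at_wrong:
  assumes b: "0 < b" and P: "sets P = sets M"
    and g: "\<And>n. g n \<in> borel_measurable (past n)"
    and h: "\<And>\<omega>. \<omega> \<in> space M \<Longrightarrow> h \<omega> = (if hit_star X b J \<omega> < hit X b J \<omega> then g (the_enat (hit_star X b J \<omega>)) \<omega> else (0::ennreal))"
  shows "h \<in> borel_measurable M"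
    and "(\<integral>\<^sup>+ \<omega>. h \<omega> \<partial>P) = (\<Sum>n. \<integral>\<^sup>+ \<omega>. indicator (wrong b n) \<omega> * g n \<omega> \<partial>P)"
proof -
  have hs: "h \<omega> = (\<Sum>n. indicator (wrong b n) \<omega> * g n \<omega>)" if w: "\<omega> \<in> space M" for \<omega>
  proof (cases "hit_star X b J \<omega> < hit X b J \<omega>")
    case True
    then obtain n where n: "hit_star X b J \<omega> = enat n" by (cases "hit_star X b J \<omega>") auto
    have "(\<Sum>n. indicator (wrong b n) \<omega> * g n \<omega>) = (\<Sum>n\<in>{n}. indicator (wrong b n) \<omega> * g n \<omega>)"
      using n by (intro suminf_finite) (auto simp: wrong_def)
    also have "\<dots> = g n \<omega>" using n True w by (simp add: wrong_def)
    finally show ?thesis using True n h[OF w] by simp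
  next
    case False
    then have "\<omega> \<notin> wrong b n" for n by (auto simp: wrong_def)
    then show ?thesis using False h[OF w] by simp
  qed
  have m: "(\<lambda>\<omega>. indicator (wrong b n) \<omega> * g n \<omega>) \<in> borel_measurable M" for n
    using wrong_past[OF b, of n] g[of n]
    by (intro measurable_past[of _ n] borel_measurable_times_ennreal borel_measurable_indicator)
  have "(\<lambda>\<omega>. \<Sum>n. indicator (wrong b n) \<omega> * g n \<omega>) \<in> borel_measurable M"
    using m by (intro borel_measurable_suminf_order)
  also have "?this \<longleftrightarrow> h \<in> borel_measurable M"
    by (intro measurable_cong) (simp add: hs)
  finally show "h \<in> borel_measurable M" .
  have "(\<integral>\<^sup>+ \<omega>. h \<omega> \<partial>P) = (\<integral>\<^sup>+ \<omega>. (\<Sum>n. indicator (wrong b n) \<omega> * g n \<omega>) \<partial>P)"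
    using sets_eq_imp_space_eq[OF P] by (intro nn_integral_cong) (simp add: hs)
  also have "\<dots> = (\<Sum>n. \<integral>\<^sup>+ \<omega>. indicator (wrong b n) \<omega> * g n \<omega> \<partial>P)"
    using m by (intro nn_integral_suminf) (simp cong: measurable_cong_sets add: measurable_cong_sets[OF P refl])
  finally show "(\<integral>\<^sup>+ \<omega>. h \<omega> \<partial>P) = (\<Sum>n. \<integral>\<^sup>+ \<omega>. indicator (wrong b n) \<omega> * g n \<omega> \<partial>P)" .
qed

lemma sum_wrong_le_1:
  assumes b: "0 < b" and P: "prob_space P" "sets P = sets M"
  shows "(\<Sum>n. emeasure P (wrong b n)) \<le> 1"
proof -
  have "(\<Sum>n. emeasure P (wrong b n)) = emeasure P (\<Union>n. wrong b n)"
    using wrong_sets[OF b] P wrong_disjoint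
    by (intro suminf_emeasure) (auto simp: disjoint_family_on_def)
  then show ?thesis using prob_space.emeasure_le_1[OF P(1)] by simp
qed

section \<open>The mixture measure and the moments of the estimator\<close>

context
  fixes \<Theta> :: "(real ^ 'n) set"
  assumes Th: "finite \<Theta>" "\<Theta> \<noteq> {}" "\<And>\<theta>. \<theta> \<in> \<Theta> \<Longrightarrow> \<Lambda> \<theta> \<le> 0"
begin

text \<open>The density of the mixture on \<open>past n\<close>. On the error event the estimator is
  its reciprocal at the stopping time.\<close>

definition mix_lik :: "nat \<Rightarrow> 'a \<Rightarrow> real" where
  "mix_lik n \<omega> = (\<Sum>\<theta>\<in>\<Theta>. lik M X \<theta> n \<omega>) / real (card \<Theta>)"

lemma card_pos: "0 < card \<Theta>" using Th by (simp add: card_gt_0_iff)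

lemma Th_edom: "\<theta> \<in> \<Theta> \<Longrightarrow> \<theta> \<in> edom \<Lambda>" using Th(3) cgf_le_0_iff by blast

lemma mix_lik_past [measurable]: "mix_lik n \<in> borel_measurable (past n)"
  unfolding mix_lik_def[abs_def] by measurable

lemma mix_lik_pos: "0 < mix_lik n \<omega>"
  using card_pos Th by (auto simp: mix_lik_def lik_pos intro!: divide_pos_pos sum_pos)

lemma sets_mixture: "sets (mixture M Q \<Theta>) = sets M"
  unfolding mixture_def by (simp add: sets.space_closed sets.sigma_sets_eq)

lemma mixture_emeasure:
  assumes E: "E \<in> filt M X n"
  shows "emeasure (mixture M Q \<Theta>) E = (\<integral>\<^sup>+ \<omega>\<in>E. ennreal (mix_lik n \<omega>) \<partial>M)"
proof -
  have E': "E \<in> sets (past n)" "E \<in> sets M"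
    using E subalgebra_past[of n] by (auto simp: sets_past subalgebra_def)
  note [measurable] = measurable_past[OF lik_past] E'(2)
  have "emeasure (mixture M Q \<Theta>) E = (\<Sum>\<theta>\<in>\<Theta>. emeasure (Q \<theta>) E) / of_nat (card \<Theta>)"
    using E' by (intro emeasure_mixture Q_sets Th_edom)
  also have "\<dots> = (\<Sum>\<theta>\<in>\<Theta>. \<integral>\<^sup>+ \<omega>. ennreal (lik M X \<theta> n \<omega>) * indicator E \<omega> \<partial>M) / of_nat (card \<Theta>)"
    using Q_emeasure[OF Th_edom E'(1)] by simp
  also have "\<dots> = (\<integral>\<^sup>+ \<omega>. (\<Sum>\<theta>\<in>\<Theta>. ennreal (lik M X \<theta> n \<omega>) * indicator E \<omega>) / of_nat (card \<Theta>) \<partial>M)"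
    by (simp add: nn_integral_sum nn_integral_divide)
  also have "\<dots> = (\<integral>\<^sup>+ \<omega>\<in>E. ennreal (mix_lik n \<omega>) \<partial>M)"
  proof (rule nn_integral_cong)
    fix \<omega>
    have "(\<Sum>\<theta>\<in>\<Theta>. ennreal (lik M X \<theta> n \<omega>)) / of_nat (card \<Theta>) = ennreal (mix_lik n \<omega>)"
      using card_pos by (simp add: mix_lik_def sum_ennreal less_imp_le[OF lik_pos] ennreal_of_nat_eq_real_of_nat
          divide_ennreal sum_nonneg)
    then show "(\<Sum>\<theta>\<in>\<Theta>. ennreal (lik M X \<theta> n \<omega>) * indicator E \<omega>) / of_nat (card \<Theta>)
        = ennreal (mix_lik n \<omega>) * indicator E \<omega>"
      by (simp split: split_indicator)
  qed
  finally show ?thesis .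
qed

lemma prob_space_mixture: "prob_space (mixture M Q \<Theta>)"
proof
  have sp: "space (mixture M Q \<Theta>) = space M" by (rule sets_eq_imp_space_eq[OF sets_mixture])
  \<comment> \<open>The empty sum makes every likelihood 1 at time 0, so the total mass can be read
    off at \<open>past 0\<close>.\<close>
  have "mix_lik 0 \<omega> = 1" for \<omega> using card_pos by (simp add: mix_lik_def lik_def S_def)
  then show "emeasure (mixture M Q \<Theta>) (space (mixture M Q \<Theta>)) = 1"
    using mixture_emeasure[of "space M" 0] sets.top[of "past 0"]
    by (simp add: sp sets_past emeasure_space_1 cong: nn_integral_cong)
qed

lemma W_hat_nonneg: "0 \<le> W_hat M X J \<Theta> b \<omega>"
  using mix_lik_pos by (auto simp: W_hat_def mix_lik_def[symmetric] less_imp_le)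

text \<open>Integrating against the mixture on \<open>wrong b n\<close> multiplies by
  \<open>mix_lik n\<close>, which cancels one factor of the estimator. The first moment is thus the
  error probability, and the second becomes an integral of the reciprocal density under
  \<open>M\<close>.\<close>

lemma W_hat_moments:
  assumes b: "0 < b"
  shows "W_hat M X J \<Theta> b \<in> borel_measurable M"
    and "(\<integral>\<^sup>+ \<omega>. ennreal (W_hat M X J \<Theta> b \<omega>) \<partial>mixture M Q \<Theta>) = ennreal (err_prob M X J b)"
    and "(\<integral>\<^sup>+ \<omega>. ennreal ((W_hat M X J \<Theta> b \<omega>)\<^sup>2) \<partial>mixture M Q \<Theta>)
      = (\<Sum>n. \<integral>\<^sup>+ \<omega>. indicator (wrong b n) \<omega> * ennreal (inverse (mix_lik n \<omega>)) \<partial>M)"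
proof -
  have com: "(\<integral>\<^sup>+ \<omega>. indicator (wrong b n) \<omega> * f \<omega> \<partial>mixture M Q \<Theta>)
      = (\<integral>\<^sup>+ \<omega>. ennreal (mix_lik n \<omega>) * (indicator (wrong b n) \<omega> * f \<omega>) \<partial>M)"
    if "f \<in> borel_measurable (past n)" for f n
    using that wrong_past[OF b, of n]
    by (intro change_of_measure[OF sets_mixture] mixture_emeasure borel_measurable_times_ennreal
        borel_measurable_indicator) auto
  have g1: "(\<lambda>\<omega>. ennreal (inverse (mix_lik n \<omega>))) \<in> borel_measurable (past n)" for n by measurable
  have g2: "(\<lambda>\<omega>. ennreal ((inverse (mix_lik n \<omega>))\<^sup>2)) \<in> borel_measurable (past n)" for n by measurable
  note n1 = nn_integral_at_wrong[OF b sets_mixture, of "\<lambda>n \<omega>. ennreal (inverse (mix_lik n \<omega>))"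
      "\<lambda>\<omega>. ennreal (W_hat M X J \<Theta> b \<omega>)", OF g1]
  note n2 = nn_integral_at_wrong[OF b sets_mixture, of "\<lambda>n \<omega>. ennreal ((inverse (mix_lik n \<omega>))\<^sup>2)"
      "\<lambda>\<omega>. ennreal ((W_hat M X J \<Theta> b \<omega>)\<^sup>2)", OF g2]
  have "(\<lambda>\<omega>. enn2real (ennreal (W_hat M X J \<Theta> b \<omega>))) \<in> borel_measurable M"
    using n1(1) by (intro borel_measurable_enn2real) (simp add: W_hat_def mix_lik_def)
  then show "W_hat M X J \<Theta> b \<in> borel_measurable M" by (simp add: W_hat_nonneg cong: measurable_cong)
  have "(\<integral>\<^sup>+ \<omega>. ennreal (W_hat M X J \<Theta> b \<omega>) \<partial>mixture M Q \<Theta>)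
      = (\<Sum>n. \<integral>\<^sup>+ \<omega>. indicator (wrong b n) \<omega> * ennreal (inverse (mix_lik n \<omega>)) \<partial>mixture M Q \<Theta>)"
    by (rule n1(2)) (simp add: W_hat_def mix_lik_def)
  also have "\<dots> = (\<Sum>n. emeasure M (wrong b n))"
  proof (rule arg_cong[where f=suminf], rule ext)
    fix n
    have "ennreal (mix_lik n \<omega>) * (indicator (wrong b n) \<omega> * ennreal (inverse (mix_lik n \<omega>)))
        = indicator (wrong b n) \<omega>" for \<omega>
      using mix_lik_pos[of n \<omega>]
      by (auto split: split_indicator simp: ennreal_mult[symmetric] less_imp_le)
    then show "(\<integral>\<^sup>+ \<omega>. indicator (wrong b n) \<omega> * ennreal (inverse (mix_lik n \<omega>)) \<partial>mixture M Q \<Theta>)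
        = emeasure M (wrong b n)"
      using com[OF g1] wrong_sets[OF b] by simp
  qed
  also have "\<dots> = emeasure M (\<Union>n. wrong b n)"
    using wrong_sets[OF b] wrong_disjoint
    by (intro suminf_emeasure) (auto simp: disjoint_family_on_def)
  also note err_event_eq[symmetric]
  finally show "(\<integral>\<^sup>+ \<omega>. ennreal (W_hat M X J \<Theta> b \<omega>) \<partial>mixture M Q \<Theta>) = ennreal (err_prob M X J b)"
    by (simp add: err_prob_def emeasure_eq_measure)
  have "(\<integral>\<^sup>+ \<omega>. ennreal ((W_hat M X J \<Theta> b \<omega>)\<^sup>2) \<partial>mixture M Q \<Theta>)
      = (\<Sum>n. \<integral>\<^sup>+ \<omega>. indicator (wrong b n) \<omega> * ennreal ((inverse (mix_lik n \<omega>))\<^sup>2) \<partial>mixture M Q \<Theta>)"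
    by (rule n2(2)) (simp add: W_hat_def mix_lik_def)
  also have "\<dots> = (\<Sum>n. \<integral>\<^sup>+ \<omega>. indicator (wrong b n) \<omega> * ennreal (inverse (mix_lik n \<omega>)) \<partial>M)"
  proof (rule arg_cong[where f=suminf], rule ext)
    fix n
    have "ennreal (mix_lik n \<omega>) * (indicator (wrong b n) \<omega> * ennreal ((inverse (mix_lik n \<omega>))\<^sup>2))
        = indicator (wrong b n) \<omega> * ennreal (inverse (mix_lik n \<omega>))" for \<omega>
      using mix_lik_pos[of n \<omega>]
      by (auto split: split_indicator simp: ennreal_mult[symmetric] less_imp_le power2_eq_square)
    then show "(\<integral>\<^sup>+ \<omega>. indicator (wrong b n) \<omega> * ennreal ((inverse (mix_lik n \<omega>))\<^sup>2) \<partial>mixture M Q \<Theta>)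
        = (\<integral>\<^sup>+ \<omega>. indicator (wrong b n) \<omega> * ennreal (inverse (mix_lik n \<omega>)) \<partial>M)"
      using com[OF g2] by simp
  qed
  finally show "(\<integral>\<^sup>+ \<omega>. ennreal ((W_hat M X J \<Theta> b \<omega>)\<^sup>2) \<partial>mixture M Q \<Theta>)
      = (\<Sum>n. \<integral>\<^sup>+ \<omega>. indicator (wrong b n) \<omega> * ennreal (inverse (mix_lik n \<omega>)) \<partial>M)" .
qed

text \<open>Since \<open>\<Lambda> \<theta> \<le> 0\<close>, the normalizing term only enlarges the
  likelihood, and on \<open>b W A\<close> the exponent is bounded below through the cone.\<close>

lemma lik_ge_on_hit:
  assumes "0 < b" "A \<in> G_minus J" "\<theta> \<in> feas A" "S X n \<omega> \<in> (\<lambda>x. b *\<^sub>R x) ` W A"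
  shows "exp (b * mass A \<theta>) \<le> lik M X \<theta> n \<omega>"
proof -
  obtain x where x: "S X n \<omega> = b *\<^sub>R x" "x \<in> W A" using assms(4) by blast
  have "b * mass A \<theta> \<le> \<theta> \<bullet> S X n \<omega>"
    using mult_left_mono[OF feas_inner_ge[OF assms(2,3) x(2)], of b] assms(1) x(1) by simp
  moreover have "real n * real_of_ereal (\<Lambda> \<theta>) \<le> 0"
    using feasD(3)[OF assms(3)] by (intro mult_nonneg_nonpos) (auto simp: real_of_ereal_le_0)
  ultimately show ?thesis by (simp add: lik_def)
qed

text \<open>On entry into \<open>b W A\<close>, the member \<theta> of \<Theta> bounds the
  reciprocal density by \<open>card \<Theta> * exp (- b * mass A \<theta>)\<close>. The partner
  \<open>\<theta>'\<close> trades the rest of the exponent for its own likelihood, whose integrals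
  over the disjoint events sum to a \<open>Q \<theta>'\<close>-probability, at most 1.\<close>

lemma second_moment_bound:
  assumes b: "0 < b"
    and pair: "\<And>A. A \<in> G_minus J \<Longrightarrow> \<exists>\<theta>\<in>\<Theta> \<inter> feas A. \<exists>\<theta>'\<in>feas A. 2 * r \<le> mass A \<theta> + mass A \<theta>'"
  shows "(\<integral>\<^sup>+ \<omega>. ennreal ((W_hat M X J \<Theta> b \<omega>)\<^sup>2) \<partial>mixture M Q \<Theta>)
    \<le> ennreal (real (card \<Theta>) * real (card (G_minus J)) * exp (- 2 * b * r))"
proof -
  define K where "K = real (card \<Theta>) * exp (- 2 * b * r)"
  have K: "0 \<le> K" by (simp add: K_def)
  obtain t0 t1 where t: "\<And>A. A \<in> G_minus J \<Longrightarrow> t0 A \<in> \<Theta>" "\<And>A. A \<in> G_minus J \<Longrightarrow> t0 A \<in> feas A"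
    "\<And>A. A \<in> G_minus J \<Longrightarrow> t1 A \<in> feas A"
    "\<And>A. A \<in> G_minus J \<Longrightarrow> 2 * r \<le> mass A (t0 A) + mass A (t1 A)"
    using pair by (metis IntD1 IntD2)
  have te: "t1 A \<in> edom \<Lambda>" if "A \<in> G_minus J" for A using feasD(1)[OF t(3)[OF that]] .
  \<comment> \<open>The set \<open>A\<close> entered depends on \<omega>; summing over all of
    \<open>G_minus J\<close> gives a bound that does not.\<close>
  have pt: "indicator (wrong b n) \<omega> * ennreal (inverse (mix_lik n \<omega>))
      \<le> (\<Sum>A\<in>G_minus J. ennreal K * (ennreal (lik M X (t1 A) n \<omega>) * indicator (wrong b n) \<omega>))" for n \<omega>
  proof (cases "\<omega> \<in> wrong b n")
    case True
    obtain A where A: "A \<in> G_minus J" "S X n \<omega> \<in> (\<lambda>x. b *\<^sub>R x) ` W A"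
      by (rule wrong_hits[OF True], rule that)
    have "exp (b * mass A (t0 A)) / real (card \<Theta>) \<le> mix_lik n \<omega>"
    proof -
      have "exp (b * mass A (t0 A)) \<le> lik M X (t0 A) n \<omega>" using lik_ge_on_hit[OF b A(1) t(2)[OF A(1)] A(2)] .
      also have "\<dots> \<le> (\<Sum>\<theta>\<in>\<Theta>. lik M X \<theta> n \<omega>)"
        using Th(1) t(1)[OF A(1)] by (intro member_le_sum) (auto simp: less_imp_le[OF lik_pos])
      finally show ?thesis by (simp add: mix_lik_def divide_right_mono)
    qed
    then have "inverse (mix_lik n \<omega>) \<le> inverse (exp (b * mass A (t0 A)) / real (card \<Theta>))"
      using card_pos by (intro le_imp_inverse_le) auto
    also have "\<dots> = real (card \<Theta>) * exp (- (b * mass A (t0 A)))"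
      by (simp add: exp_minus divide_simps)
    also have "\<dots> \<le> real (card \<Theta>) * (exp (- 2 * b * r) * exp (b * mass A (t1 A)))"
      using mult_left_mono[OF t(4)[OF A(1)], of b] b
      by (intro mult_left_mono) (auto simp: exp_add[symmetric] algebra_simps)
    also have "\<dots> = K * exp (b * mass A (t1 A))" by (simp add: K_def)
    also have "\<dots> \<le> K * lik M X (t1 A) n \<omega>"
      using lik_ge_on_hit[OF b A(1) t(3)[OF A(1)] A(2)] K by (intro mult_left_mono)
    finally have "ennreal (inverse (mix_lik n \<omega>)) \<le> ennreal K * ennreal (lik M X (t1 A) n \<omega>)"
      using K by (simp add: ennreal_mult[symmetric] less_imp_le[OF lik_pos])
    also have "\<dots> \<le> (\<Sum>A\<in>G_minus J. ennreal K * ennreal (lik M X (t1 A) n \<omega>))"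
      using A(1) by (intro member_le_sum) auto
    finally show ?thesis using True by simp
  qed simp
  note [measurable] = measurable_past[OF lik_past] wrong_sets[OF b]
  have "(\<Sum>n. \<integral>\<^sup>+ \<omega>. indicator (wrong b n) \<omega> * ennreal (inverse (mix_lik n \<omega>)) \<partial>M)
     \<le> (\<Sum>n. \<integral>\<^sup>+ \<omega>. (\<Sum>A\<in>G_minus J. ennreal K * (ennreal (lik M X (t1 A) n \<omega>) * indicator (wrong b n) \<omega>)) \<partial>M)"
    by (intro suminf_le nn_integral_mono pt) auto
  also have "\<dots> = (\<Sum>n. \<Sum>A\<in>G_minus J. ennreal K * emeasure (Q (t1 A)) (wrong b n))"
    using Q_emeasure[OF te wrong_past[OF b]]
    by (simp add: nn_integral_sum nn_integral_cmult)
  also have "\<dots> = (\<Sum>A\<in>G_minus J. ennreal K * (\<Sum>n. emeasure (Q (t1 A)) (wrong b n)))"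
    by (subst suminf_sum) auto
  also have "\<dots> \<le> (\<Sum>A\<in>G_minus J. ennreal K * 1)"
    using Q_prob[OF te] Q_sets[OF te]
    by (intro sum_mono mult_left_mono sum_wrong_le_1[OF b]) auto
  also have "\<dots> = ennreal (real (card \<Theta>) * real (card (G_minus J)) * exp (- 2 * b * r))"
    using K by (simp add: K_def ennreal_of_nat_eq_real_of_nat ennreal_mult[symmetric] mult_ac)
  finally show ?thesis by (simp only: W_hat_moments(3)[OF b])
qed

text \<open>The lower bound is the nonnegativity of the variance, the mean being the error
  probability.\<close>

lemma second_moment_bounds:
  assumes b: "0 < b"
    and pair: "\<And>A. A \<in> G_minus J \<Longrightarrow> \<exists>\<theta>\<in>\<Theta> \<inter> feas A. \<exists>\<theta>'\<in>feas A. 2 * r \<le> mass A \<theta> + mass A \<theta>'"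
  shows "(\<integral>\<omega>. (W_hat M X J \<Theta> b \<omega>)\<^sup>2 \<partial>mixture M Q \<Theta>)
      \<le> real (card \<Theta>) * real (card (G_minus J)) * exp (- 2 * b * r)"
    and "(err_prob M X J b)\<^sup>2 \<le> (\<integral>\<omega>. (W_hat M X J \<Theta> b \<omega>)\<^sup>2 \<partial>mixture M Q \<Theta>)"
proof -
  interpret mix: prob_space "mixture M Q \<Theta>" by (rule prob_space_mixture)
  let ?W = "W_hat M X J \<Theta> b" and ?p = "err_prob M X J b"
  have Wm [measurable]: "?W \<in> borel_measurable (mixture M Q \<Theta>)"
    using W_hat_moments(1)[OF b] by (simp add: measurable_cong_sets[OF sets_mixture refl])
  note B = second_moment_bound[OF b pair]
  \<comment> \<open>Finiteness comes first, since the Bochner integral of a non-integrable function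
    is 0 by default.\<close>
  have i2: "integrable (mixture M Q \<Theta>) (\<lambda>\<omega>. (?W \<omega>)\<^sup>2)"
    using B by (intro integrableI_nonneg) (auto simp: less_top[symmetric] top_unique)
  have i1: "integrable (mixture M Q \<Theta>) ?W"
    using W_hat_moments(2)[OF b] by (intro integrableI_nonneg) (auto simp: W_hat_nonneg)
  have e1: "(\<integral>\<omega>. ?W \<omega> \<partial>mixture M Q \<Theta>) = ?p"
    using W_hat_moments(2)[OF b]
    by (subst integral_eq_nn_integral) (auto simp: W_hat_nonneg err_prob_def)
  show "(\<integral>\<omega>. (?W \<omega>)\<^sup>2 \<partial>mixture M Q \<Theta>) \<le> real (card \<Theta>) * real (card (G_minus J)) * exp (- 2 * b * r)"
    using B nn_integral_eq_integral[OF i2] by simp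
  have "0 \<le> (\<integral>\<omega>. (?W \<omega> - ?p)\<^sup>2 \<partial>mixture M Q \<Theta>)" by simp
  also have "\<dots> = (\<integral>\<omega>. (?W \<omega>)\<^sup>2 - 2 * ?p * ?W \<omega> + ?p\<^sup>2 \<partial>mixture M Q \<Theta>)"
    by (simp add: power2_diff algebra_simps)
  also have "\<dots> = (\<integral>\<omega>. (?W \<omega>)\<^sup>2 \<partial>mixture M Q \<Theta>) - ?p\<^sup>2"
    using i1 i2 by (simp add: e1 mix.prob_space power2_eq_square)
  finally show "?p\<^sup>2 \<le> (\<integral>\<omega>. (?W \<omega>)\<^sup>2 \<partial>mixture M Q \<Theta>)" by simp
qed

end

end

subsection \<open>The error probability\<close>

text \<open>Both logarithms are eventually negative, so \<open>jensen\<close> bounds the ratio above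
  by 1. The other two bounds give a lower bound tending to \<open>r / (r + \<epsilon>)\<close>, and
  \<epsilon> is arbitrary.\<close>

lemma log_ratio_tendsto_1:
  fixes p E :: "real \<Rightarrow> real"
  assumes r: "0 < r" and C: "0 < C"
    and upper: "\<And>b. 0 < b \<Longrightarrow> E b \<le> C * exp (- 2 * b * r)"
    and jensen: "\<And>b. 0 < b \<Longrightarrow> (p b)\<^sup>2 \<le> E b"
    and lower: "\<And>\<epsilon>. 0 < \<epsilon> \<Longrightarrow> eventually (\<lambda>b. exp (- b * (r + \<epsilon>)) \<le> p b) at_top"
  shows "((\<lambda>b. ln (E b) / (2 * ln (p b))) \<longlongrightarrow> 1) at_top"
proof -
  have main: "eventually (\<lambda>b. (2 * b * r - ln C) / (2 * b * (r + \<epsilon>)) \<le> ln (E b) / (2 * ln (p b))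
      \<and> ln (E b) / (2 * ln (p b)) \<le> 1) at_top" if \<epsilon>: "0 < \<epsilon>" for \<epsilon>
    using lower[OF \<epsilon>] eventually_gt_at_top[of 0] eventually_gt_at_top[of "ln C / (2 * r)"]
  proof eventually_elim
    case (elim b)
    have p: "0 < p b" using elim(1) exp_gt_zero[of "- b * (r + \<epsilon>)"] by linarith
    have E: "0 < E b" using jensen[OF elim(2)] p zero_less_power[of "p b" 2] by linarith
    have "ln (E b) \<le> ln (C * exp (- 2 * b * r))" using upper[OF elim(2)] E by simp
    then have lE: "2 * b * r - ln C \<le> - ln (E b)" using C by (simp add: ln_mult)
    \<comment> \<open>Positivity of this numerator makes both logarithms negative, which fixes the
      direction of the divisions below.\<close>
    have pos: "0 < 2 * b * r - ln C" using elim(3) r by (simp add: pos_divide_less_eq algebra_simps)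
    have "ln ((p b)\<^sup>2) \<le> ln (E b)" using jensen[OF elim(2)] p E by simp
    then have pE: "- ln (E b) \<le> - (2 * ln (p b))" using p by (simp add: ln_realpow)
    have "ln (exp (- b * (r + \<epsilon>))) \<le> ln (p b)" using elim(1) p by (subst ln_le_cancel_iff) auto
    then have lp: "- (2 * ln (p b)) \<le> 2 * b * (r + \<epsilon>)" by simp
    have y: "0 < - (2 * ln (p b))" using lE pE pos by linarith
    have eq: "ln (E b) / (2 * ln (p b)) = - ln (E b) / - (2 * ln (p b))" by simp
    have "(2 * b * r - ln C) / (2 * b * (r + \<epsilon>)) \<le> - ln (E b) / - (2 * ln (p b))"
      using pos lE lp y by (intro frac_le) auto
    moreover have "- ln (E b) / - (2 * ln (p b)) \<le> 1" using pE y by (simp add: pos_divide_le_eq)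
    ultimately show ?case unfolding eq by simp
  qed
  show ?thesis
  proof (rule order_tendstoI)
    fix a :: real assume "1 < a"
    then show "eventually (\<lambda>b. ln (E b) / (2 * ln (p b)) < a) at_top"
      using main[of 1] by (auto elim!: eventually_mono)
  next
    fix a :: real assume a: "a < 1"
    \<comment> \<open>Raising \<open>a\<close> to at least 1/2 allows division by \<open>a'\<close>;
      \<epsilon> then makes \<open>a' * (r + \<epsilon>)\<close> the midpoint of
      \<open>r * a'\<close> and \<open>r\<close>.\<close>
    define a' where "a' = max a (1 / 2)"
    define \<epsilon> where "\<epsilon> = r * (1 - a') / (2 * a')"
    have a': "a \<le> a'" "0 < a'" "a' < 1" using a by (auto simp: a'_def)
    have \<epsilon>: "0 < \<epsilon>" using r a' by (simp add: \<epsilon>_def)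
    have "a' * (r + \<epsilon>) = r * (1 + a') / 2" using a' by (simp add: \<epsilon>_def field_simps)
    also have "\<dots> < r" using r a' by simp
    finally have lim: "a' < r / (r + \<epsilon>)" using r \<epsilon> by (simp add: pos_less_divide_eq)
    have "((\<lambda>b. (2 * b * r - ln C) / (2 * b * (r + \<epsilon>))) \<longlongrightarrow> r / (r + \<epsilon>)) at_top"
    proof -
      have "r * 2 * inverse (2 * (r + \<epsilon>)) = r / (r + \<epsilon>)" using r \<epsilon> by (simp add: field_simps)
      moreover have "((\<lambda>b. (2 * b * r - ln C) / (2 * b * (r + \<epsilon>))) \<longlongrightarrow> r * 2 * inverse (2 * (r + \<epsilon>))) at_top"
        using r \<epsilon> by real_asymp
      ultimately show ?thesis by simp
    qed
    from order_tendstoD(1)[OF this lim] main[OF \<epsilon>]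
    show "eventually (\<lambda>b. a < ln (E b) / (2 * ln (p b))) at_top"
      by eventually_elim (use a' in linarith)
  qed
qed

context tilted_walk
begin

text \<open>Exponential Markov inequality under \<open>Q \<beta>\<close>: an extra tilt by a small
  multiple of \<open>u\<close> costs \<open>mgf (\<beta> + t *\<^sub>R u) \<le> exp (t * m + C *
  t\<^sup>2)\<close> per step. The rate \<open>c\<close> is uniform over all times up to
  \<open>K * b\<close>.\<close>

lemma chernoff:
  assumes \<beta>: "\<beta> \<in> edom \<Lambda>" "mgf \<beta> = 1" and \<delta>: "0 < \<delta>" and K: "0 \<le> K"
  shows "\<exists>c>0. \<forall>b>0. \<forall>i. real i \<le> K * b \<longrightarrow>
    emeasure (Q \<beta>) {\<omega> \<in> space M. real i * (u \<bullet> tmean \<beta>) + \<delta> * b < u \<bullet> S X i \<omega>} \<le> ennreal (exp (- c * b))"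
proof -
  obtain \<eta> C where \<eta>: "0 < \<eta>" "0 \<le> C"
    "\<And>t. \<bar>t\<bar> \<le> \<eta> \<Longrightarrow> \<beta> + t *\<^sub>R u \<in> edom \<Lambda>"
    "\<And>t. \<bar>t\<bar> \<le> \<eta> \<Longrightarrow> mgf (\<beta> + t *\<^sub>R u) \<le> mgf \<beta> + t * (u \<bullet> tmean \<beta>) + C * t\<^sup>2"
    by (rule mgf_direction[OF \<beta>(1), of u], rule that)
  define m where "m = u \<bullet> tmean \<beta>"
  \<comment> \<open>So small that the quadratic error accumulated over \<open>K * b\<close> steps is
    at most half of the gain \<open>t * \<delta> * b\<close>.\<close>
  define t where "t = min \<eta> (\<delta> / (2 * (C * K + 1)))"
  have CK: "0 < C * K + 1" using \<eta>(2) K by (simp add: add_nonneg_pos)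
  have t: "0 < t" "t \<le> \<eta>" "t \<le> \<delta> / (2 * (C * K + 1))"
    using \<eta>(1) \<delta> CK by (auto simp: t_def)
  have "t * (2 * (C * K + 1)) \<le> \<delta>" using t(3) CK by (simp add: pos_le_divide_eq)
  then have tCK: "t * (C * K) \<le> \<delta> / 2" using t(1) by (simp add: algebra_simps)
  have te: "\<beta> + t *\<^sub>R u \<in> edom \<Lambda>" using \<eta>(3)[of t] t by simp
  have mg: "mgf (\<beta> + t *\<^sub>R u) \<le> exp (t * m + C * t\<^sup>2)"
    using \<eta>(4)[of t] t exp_ge_add_one_self[of "t * m + C * t\<^sup>2"] unfolding m_def \<beta>(2) by linarith
  have "emeasure (Q \<beta>) {\<omega> \<in> space M. real i * m + \<delta> * b < u \<bullet> S X i \<omega>} \<le> ennreal (exp (- (t * \<delta> / 2) * b))"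
    if b: "0 < b" "real i \<le> K * b" for b i
  proof -
    let ?E = "{\<omega> \<in> space M. real i * m + \<delta> * b < u \<bullet> S X i \<omega>}"
    define k where "k = exp (- t * (real i * m + \<delta> * b))"
    have "{\<omega> \<in> space (past i). real i * m + \<delta> * b < u \<bullet> S X i \<omega>} \<in> sets (past i)" by measurable
    then have E: "?E \<in> sets (past i)" by simp
    note [measurable] = measurable_past[OF S_past_self]
    have "emeasure (Q \<beta>) ?E = (\<integral>\<^sup>+ \<omega>. ennreal (lik M X \<beta> i \<omega>) * indicator ?E \<omega> \<partial>M)"
      using \<beta>(1) E by (rule Q_emeasure)
    also have "\<dots> \<le> (\<integral>\<^sup>+ \<omega>. ennreal k * ennreal (exp ((\<beta> + t *\<^sub>R u) \<bullet> S X i \<omega>)) \<partial>M)"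
    proof (intro nn_integral_mono)
      fix \<omega>
      have "exp (\<beta> \<bullet> S X i \<omega>) \<le> k * exp ((\<beta> + t *\<^sub>R u) \<bullet> S X i \<omega>)" if "\<omega> \<in> ?E"
      proof -
        have "t * (real i * m + \<delta> * b) \<le> t * (u \<bullet> S X i \<omega>)"
          using that t by (intro mult_left_mono) auto
        then show ?thesis by (simp add: k_def exp_add[symmetric] inner_add_left)
      qed
      then show "ennreal (lik M X \<beta> i \<omega>) * indicator ?E \<omega> \<le> ennreal k * ennreal (exp ((\<beta> + t *\<^sub>R u) \<bullet> S X i \<omega>))"
        unfolding lik_eq[OF \<beta>(1)] \<beta>(2)
        by (auto split: split_indicator simp: ennreal_mult[symmetric] k_def intro!: ennreal_leI)
    qed
    also have "\<dots> = ennreal k * ennreal (mgf (\<beta> + t *\<^sub>R u) ^ i)"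
      by (simp add: nn_integral_cmult nn_integral_exp_S[OF te])
    also have "\<dots> \<le> ennreal k * ennreal (exp (t * m + C * t\<^sup>2) ^ i)"
      using mgf_pos[OF te] mg by (intro mult_left_mono ennreal_leI power_mono) auto
    also have "\<dots> = ennreal (exp (real i * (C * t\<^sup>2) - t * \<delta> * b))"
      by (simp add: k_def ennreal_mult[symmetric] exp_of_nat_mult[symmetric] exp_add[symmetric] algebra_simps)
    also have "\<dots> \<le> ennreal (exp (- (t * \<delta> / 2) * b))"
    proof -
      have "real i * (C * t\<^sup>2) \<le> (K * b) * (C * t\<^sup>2)" using b \<eta>(2) by (intro mult_right_mono) auto
      also have "\<dots> = (t * (C * K)) * (t * b)" by (simp add: power2_eq_square)
      also have "\<dots> \<le> \<delta> / 2 * (t * b)" using tCK t b by (intro mult_right_mono) auto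
      finally show ?thesis by (intro ennreal_leI) (simp add: algebra_simps)
    qed
    finally show ?thesis .
  qed
  then show ?thesis unfolding m_def[symmetric] using t(1) \<delta> by (intro exI[of _ "t * \<delta> / 2"]) auto
qed

text \<open>Under the tilted law the walk follows the ray through its mean, which enters \<open>b W A\<close> at
  time about \<open>b * mass A \<beta> / (\<beta> \<bullet> tmean \<beta>)\<close>, where the likelihood is about \<open>exp (b * mass A \<beta>)\<close>.\<close>

lemma err_prob_lower:
  assumes A: "A \<in> G_minus J" and opt: "optimal A \<beta>" and \<epsilon>: "0 < \<epsilon>"
  shows "eventually (\<lambda>b. exp (- b * (mass A \<beta> + \<epsilon>)) \<le> err_prob M X J b) at_top"
proof -
  define r where "r = mass A \<beta>"
  define v where "v = tmean \<beta>"
  define d where "d = \<beta> \<bullet> v"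
  have \<beta>f: "\<beta> \<in> feas A" by (rule opt_feas[OF A opt])
  have \<beta>e: "\<beta> \<in> edom \<Lambda>" "mgf \<beta> = 1" using feasD(1)[OF \<beta>f] opt_mgf[OF A opt] by auto
  have r: "0 < r" and d: "0 < d"
    using opt_mass_pos[OF A opt] opt_inner_pos[OF A opt] by (auto simp: r_def d_def v_def)
  have gap: "d \<le> r * (v $ k - v $ k')" if "k \<in> A" "k' \<notin> A" for k k'
    using opt_gap[OF A opt that] by (simp add: r_def d_def v_def)
  \<comment> \<open>The relative overshoot of the mean path past the boundary. Together with the
    fluctuations it costs \<open>3 * r * \<kappa> / 2\<close> in the exponent per unit of
    \<open>b\<close>, at most \<open>\<epsilon> / 2\<close>.\<close>
  define \<kappa> where "\<kappa> = min 1 (\<epsilon> / (3 * r))"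
  have \<kappa>: "0 < \<kappa>" "\<kappa> \<le> 1" "\<kappa> \<le> \<epsilon> / (3 * r)" using \<epsilon> r by (auto simp: \<kappa>_def)
  have \<kappa>r: "r * (\<kappa> * 3) \<le> \<epsilon>" using \<kappa>(3) r by (simp add: pos_le_divide_eq mult_ac)
  \<comment> \<open>Two coordinate deviations of size \<open>\<delta> * b\<close> use up only half
    of the surplus \<open>\<kappa> * b\<close>.\<close>
  define \<delta> where "\<delta> = \<kappa> / 4"
  have \<delta>: "0 < \<delta>" using \<kappa> by (simp add: \<delta>_def)
  \<comment> \<open>After \<open>s * b\<close> steps the mean path has gaps of at least
    \<open>(1 + \<kappa>) * b\<close> across \<open>A\<close>, because every gap of \<open>v\<close>
    is at least \<open>d / r\<close>.\<close>
  define s where "s = r * (1 + \<kappa>) / d"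
  have s: "0 < s" using r d \<kappa> by (simp add: s_def)
  define n where "n b = nat \<lceil>s * b\<rceil>" for b
  have n: "s * b \<le> real (n b)" "real (n b) \<le> s * b + 1" if "0 < b" for b
  proof -
    have "real (n b) = of_int \<lceil>s * b\<rceil>" using s that by (simp add: n_def)
    then show "s * b \<le> real (n b)" "real (n b) \<le> s * b + 1" using ceiling_correct[of "s * b"] by linarith+
  qed
  define K where "K = s + 1"
  \<comment> \<open>Signed coordinate directions: outside the bad events the walk stays in a tube
    around its mean path.\<close>
  define U :: "(real ^ 'n) set" where "U = range (\<lambda>k. axis k 1) \<union> range (\<lambda>k. - axis k 1)"
  have U: "finite U" "U \<noteq> {}" by (auto simp: U_def)
  define bad where "bad b i u = {\<omega> \<in> space M. real i * (u \<bullet> v) + \<delta> * b < u \<bullet> S X i \<omega>}" for b i u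
  have "\<forall>u\<in>U. \<exists>c>0. \<forall>b>0. \<forall>i. real i \<le> K * b \<longrightarrow> emeasure (Q \<beta>) (bad b i u) \<le> ennreal (exp (- c * b))"
    unfolding bad_def v_def using s by (intro ballI chernoff[OF \<beta>e \<delta>]) (simp add: K_def)
  then obtain cf where cf: "\<And>u. u \<in> U \<Longrightarrow> 0 < cf u"
    "\<And>u b i. u \<in> U \<Longrightarrow> 0 < b \<Longrightarrow> real i \<le> K * b \<Longrightarrow> emeasure (Q \<beta>) (bad b i u) \<le> ennreal (exp (- cf u * b))"
    by metis
  define c where "c = Min (cf ` U)"
  have c: "0 < c" "\<And>u. u \<in> U \<Longrightarrow> c \<le> cf u" using U cf(1) by (auto simp: c_def)
  have bad_past: "bad b i u \<in> sets (past m)" if "i \<le> m" for b i u m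
  proof -
    note S_past[OF that, measurable]
    have "{\<omega> \<in> space (past m). real i * (u \<bullet> v) + \<delta> * b < u \<bullet> S X i \<omega>} \<in> sets (past m)" by measurable
    then show ?thesis by (simp add: bad_def)
  qed
  define D where "D = real (card U)"
  \<comment> \<open>\<open>K * b + 1\<close> bounds the number of times from 0 to
    \<open>n b\<close>, and the summand \<open>d\<close> in the exponent pays for rounding
    \<open>n b\<close> up.\<close>
  have bound: "(1 - (K * b + 1) * D * exp (- c * b)) * exp (- (b * (r + \<epsilon> / 2) + d)) \<le> err_prob M X J b"
    if b: "1 \<le> b" for b
  proof -
    have b0: "0 < b" using b by simp
    have nK: "real (n b) \<le> K * b" using n(2)[OF b0] b by (simp add: K_def algebra_simps)
    define B where "B = (\<Union>i\<in>{..n b}. \<Union>u\<in>U. bad b i u)"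
    have B: "B \<in> sets (past (n b))"
      unfolding B_def using U by (intro sets.finite_UN bad_past) auto
    define G where "G = space M - B"
    have G: "G \<in> sets (past (n b))" using sets.compl_sets[OF B] by (simp add: G_def)
    interpret Qb: prob_space "Q \<beta>" by (rule Q_prob[OF \<beta>e(1)])
    have sQ: "space (Q \<beta>) = space M" by (rule sets_eq_imp_space_eq[OF Q_sets[OF \<beta>e(1)]])
    have pastQ: "sets (past m) \<subseteq> sets (Q \<beta>)" for m
      using subalgebra_past[of m] Q_sets[OF \<beta>e(1)] by (simp add: subalgebra_def)
    have badQ: "bad b i u \<in> Qb.events" for i u
      using bad_past[OF order_refl] pastQ by blast
    have bd: "measure (Q \<beta>) (bad b i u) \<le> exp (- c * b)" if "i \<le> n b" "u \<in> U" for i u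
    proof -
      have "real i \<le> K * b" using that nK by (meson of_nat_mono order_trans)
      then have "measure (Q \<beta>) (bad b i u) \<le> exp (- cf u * b)"
        using cf(2)[OF that(2) b0] by (simp add: Qb.emeasure_eq_measure)
      also have "\<dots> \<le> exp (- c * b)" using c(2)[OF that(2)] b0 by simp
      finally show ?thesis .
    qed
    have "measure (Q \<beta>) B \<le> (\<Sum>i\<in>{..n b}. measure (Q \<beta>) (\<Union>u\<in>U. bad b i u))"
      unfolding B_def using U badQ
      by (intro Qb.finite_measure_subadditive_finite) (auto intro!: sets.finite_UN)
    also have "\<dots> \<le> (\<Sum>i\<in>{..n b}. \<Sum>u\<in>U. measure (Q \<beta>) (bad b i u))"
      using U badQ
      by (intro sum_mono Qb.finite_measure_subadditive_finite) auto
    also have "\<dots> \<le> (\<Sum>i\<in>{..n b}. \<Sum>u\<in>U. exp (- c * b))"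
      by (intro sum_mono bd) auto
    also have "\<dots> = (real (n b) + 1) * (D * exp (- c * b))" by (simp add: D_def)
    also have "\<dots> \<le> (K * b + 1) * (D * exp (- c * b))"
      using nK by (intro mult_right_mono) (auto simp: D_def)
    finally have "measure (Q \<beta>) B \<le> (K * b + 1) * D * exp (- c * b)" by (simp add: mult.assoc)
    then have QG: "1 - (K * b + 1) * D * exp (- c * b) \<le> measure (Q \<beta>) G"
      using Qb.prob_compl[of B] subsetD[OF pastQ B] by (simp add: G_def sQ)
    have tube: "\<bar>S X i \<omega> $ k - real i * v $ k\<bar> \<le> \<delta> * b" if "\<omega> \<in> G" "i \<le> n b" for \<omega> i k
    proof -
      have "axis k 1 \<in> U" "- axis k 1 \<in> U" by (auto simp: U_def)
      then have "\<omega> \<notin> bad b i (axis k 1)" "\<omega> \<notin> bad b i (- axis k 1)" "\<omega> \<in> space M"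
        using that by (auto simp: G_def B_def)
      then show ?thesis by (simp add: bad_def inner_axis')
    qed
    have sub: "G \<subseteq> {\<omega> \<in> space M. hit_star X b J \<omega> < hit X b J \<omega>}"
    proof
      fix \<omega> assume w: "\<omega> \<in> G"
      have "S X (n b) \<omega> \<in> (\<lambda>x. b *\<^sub>R x) ` W A"
        unfolding in_scaled_W_iff[OF b0]
      proof (intro ballI)
        fix k k' assume k: "k \<in> A" "k' \<in> - A"
        have g: "d / r \<le> v $ k - v $ k'" using gap[of k k'] k r by (simp add: pos_divide_le_eq mult.commute)
        have "(1 + \<kappa>) * b = s * b * (d / r)" using d r by (simp add: s_def)
        also have "\<dots> \<le> real (n b) * (v $ k - v $ k')"
          using n(1)[OF b0] g d r by (intro mult_mono) auto
        finally have "(1 + \<kappa>) * b \<le> real (n b) * v $ k - real (n b) * v $ k'" by (simp add: algebra_simps)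
        moreover have "\<kappa> * b = 4 * (\<delta> * b)" "0 < \<delta> * b" using \<delta> b0 by (auto simp: \<delta>_def)
        ultimately show "b < S X (n b) \<omega> $ k - S X (n b) \<omega> $ k'"
          using tube[OF w order_refl, of k] tube[OF w order_refl, of k'] by (simp add: algebra_simps)
      qed
      then have "hit_star X b J \<omega> \<le> enat (n b)"
        using A by (auto simp: hit_star_le_iff[OF G_minus_nonempty] hit_le_iff)
      \<comment> \<open>Entering \<open>b W J\<close> requires some \<open>k'\<close> in
        \<open>J - A\<close> to lead some \<open>k\<close> in \<open>A - J\<close> by more than
        \<open>b\<close>. The mean path never has \<open>k'\<close> ahead, and the tube contributes
        at most \<open>b / 2\<close>.\<close>
      moreover have "\<not> hit X b J \<omega> \<le> enat (n b)"
      proof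
        assume "hit X b J \<omega> \<le> enat (n b)"
        then obtain i where i: "i \<le> n b" "S X i \<omega> \<in> (\<lambda>x. b *\<^sub>R x) ` W J" by (auto simp: hit_le_iff)
        obtain k k' where k: "k \<in> A" "k \<notin> J" "k' \<in> J" "k' \<notin> A"
          using G_minus_card_diff(2,3)[OF A] by blast
        have "0 < r * (v $ k - v $ k')" using gap[OF k(1,4)] d by linarith
        then have "0 \<le> v $ k - v $ k'" using r by (simp add: zero_less_mult_iff)
        then have "0 \<le> real i * (v $ k - v $ k')" by (rule mult_nonneg_nonneg[OF of_nat_0_le_iff])
        then have "real i * v $ k' \<le> real i * v $ k" unfolding right_diff_distrib by linarith
        moreover have "b < S X i \<omega> $ k' - S X i \<omega> $ k"
          using i(2) k by (simp add: in_scaled_W_iff[OF b0])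
        moreover have "4 * (\<delta> * b) \<le> b" using \<kappa> b0 by (simp add: \<delta>_def mult_left_le_one_le)
        ultimately show False
          using tube[OF w i(1), of k] tube[OF w i(1), of k'] b0 by linarith
      qed
      ultimately show "\<omega> \<in> {\<omega> \<in> space M. hit_star X b J \<omega> < hit X b J \<omega>}"
        using w by (auto simp: G_def)
    qed
    have lk: "lik M X \<beta> (n b) \<omega> \<le> exp (b * (r + \<epsilon> / 2) + d)" if w: "\<omega> \<in> G" for \<omega>
    proof -
      have "\<beta> \<bullet> S X (n b) \<omega> - real (n b) * d = (\<Sum>k\<in>UNIV. \<beta> $ k * (S X (n b) \<omega> $ k - real (n b) * v $ k))"
        by (simp add: d_def inner_vec_def sum_subtractf sum_distrib_left algebra_simps)
      also have "\<dots> \<le> (\<Sum>k\<in>UNIV. \<bar>\<beta> $ k\<bar> * (\<delta> * b))"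
      proof (rule sum_mono)
        fix k
        have "\<beta> $ k * (S X (n b) \<omega> $ k - real (n b) * v $ k) \<le> \<bar>\<beta> $ k\<bar> * \<bar>S X (n b) \<omega> $ k - real (n b) * v $ k\<bar>"
          by (metis abs_ge_self abs_mult)
        also have "\<dots> \<le> \<bar>\<beta> $ k\<bar> * (\<delta> * b)" by (intro mult_left_mono tube[OF w]) auto
        finally show "\<beta> $ k * (S X (n b) \<omega> $ k - real (n b) * v $ k) \<le> \<bar>\<beta> $ k\<bar> * (\<delta> * b)" .
      qed
      also have "\<dots> = 2 * r * (\<delta> * b)"
        using block_cone_abs_sum[OF feasD(4)[OF \<beta>f]] by (simp add: sum_distrib_right[symmetric] r_def)
      finally have "\<beta> \<bullet> S X (n b) \<omega> \<le> real (n b) * d + 2 * r * (\<delta> * b)" by simp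
      also have "real (n b) * d \<le> (s * b + 1) * d" using n(2)[OF b0] d by (intro mult_right_mono) auto
      also have "(s * b + 1) * d + 2 * r * (\<delta> * b) = b * (r + r * (\<kappa> * 3) / 2) + d"
        using d by (simp add: s_def \<delta>_def field_simps)
      also have "\<dots> \<le> b * (r + \<epsilon> / 2) + d" using \<kappa>r b0 by (simp add: mult_ac)
      finally show ?thesis unfolding lik_eq[OF \<beta>e(1)] \<beta>e(2) by simp
    qed
    have GM: "G \<in> sets M" using G subalgebra_past[of "n b"] by (auto simp: subalgebra_def)
    have eG: "{\<omega> \<in> space M. hit_star X b J \<omega> < hit X b J \<omega>} \<in> sets M"
      unfolding err_event_eq using wrong_sets[OF b0] by auto
    have "emeasure (Q \<beta>) G = (\<integral>\<^sup>+ \<omega>. ennreal (lik M X \<beta> (n b) \<omega>) * indicator G \<omega> \<partial>M)"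
      by (rule Q_emeasure[OF \<beta>e(1) G])
    also have "\<dots> \<le> (\<integral>\<^sup>+ \<omega>. ennreal (exp (b * (r + \<epsilon> / 2) + d)) * indicator G \<omega> \<partial>M)"
      using lk by (intro nn_integral_mono) (auto split: split_indicator intro!: ennreal_leI)
    also have "\<dots> = ennreal (exp (b * (r + \<epsilon> / 2) + d)) * emeasure M G"
      using GM by (simp add: nn_integral_cmult_indicator)
    finally have "measure (Q \<beta>) G \<le> exp (b * (r + \<epsilon> / 2) + d) * measure M G"
      by (simp add: Qb.emeasure_eq_measure emeasure_eq_measure ennreal_mult[symmetric])
    also have "\<dots> \<le> exp (b * (r + \<epsilon> / 2) + d) * err_prob M X J b"
      unfolding err_prob_def using sub eG by (intro mult_left_mono finite_measure_mono) auto
    finally have "1 - (K * b + 1) * D * exp (- c * b) \<le> exp (b * (r + \<epsilon> / 2) + d) * err_prob M X J b"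
      using QG by simp
    from mult_right_mono[OF this, of "exp (- (b * (r + \<epsilon> / 2) + d))"]
    have "(1 - (K * b + 1) * D * exp (- c * b)) * exp (- (b * (r + \<epsilon> / 2) + d))
        \<le> err_prob M X J b * (exp (b * (r + \<epsilon> / 2) + d) * exp (- (b * (r + \<epsilon> / 2) + d)))"
      by (simp only: exp_ge_zero mult_ac)
    also have "exp (b * (r + \<epsilon> / 2) + d) * exp (- (b * (r + \<epsilon> / 2) + d)) = 1"
      unfolding exp_add[symmetric] by simp
    finally show ?thesis by simp
  qed
  have "((\<lambda>b. (K * b + 1) * D * exp (- c * b)) \<longlongrightarrow> 0) at_top" using c(1) by real_asymp
  then have "eventually (\<lambda>b. (K * b + 1) * D * exp (- c * b) < 1 / 2) at_top"
    by (rule order_tendstoD) simp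
  \<comment> \<open>Half of the exponent \<epsilon> absorbs the constant \<open>d\<close> and the
    factor 1/2 left by the good event.\<close>
  moreover have "eventually (\<lambda>b. exp (- (b * (r + \<epsilon>))) \<le> 1 / 2 * exp (- (b * (r + \<epsilon> / 2) + d))) at_top"
    using eventually_ge_at_top[of "2 / \<epsilon> * (d + ln 2)"]
  proof eventually_elim
    case (elim b)
    then have "d + ln 2 \<le> b * \<epsilon> / 2" using \<epsilon> by (simp add: field_simps)
    then have "exp (- (b * (r + \<epsilon>))) \<le> exp (- ln 2 - (b * (r + \<epsilon> / 2) + d))"
      by (simp add: algebra_simps)
    also have "\<dots> = 1 / 2 * exp (- (b * (r + \<epsilon> / 2) + d))"
      unfolding exp_diff by (simp add: exp_minus field_simps)
    finally show ?case .
  qed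
  ultimately show ?thesis
    using eventually_ge_at_top[of 1]
  proof eventually_elim
    case (elim b)
    have "exp (- (b * (r + \<epsilon>))) \<le> 1 / 2 * exp (- (b * (r + \<epsilon> / 2) + d))" by (rule elim(2))
    also have "\<dots> \<le> (1 - (K * b + 1) * D * exp (- c * b)) * exp (- (b * (r + \<epsilon> / 2) + d))"
      using elim(1) by (intro mult_right_mono) auto
    also have "\<dots> \<le> err_prob M X J b" using bound[OF elim(3)] .
    finally show ?case by (simp add: r_def)
  qed
qed

end

section \<open>Consequences of the two conditions\<close>

context gap_rule
begin

definition r_one :: real where
  "r_one = Min ((\<lambda>A. mass A (beta \<Lambda> A)) ` G_one J)"

lemma r_set_beta: "A \<in> G_minus J \<Longrightarrow> r_set \<Lambda> A = ereal (mass A (beta \<Lambda> A))"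
  using r_set_eq beta_optimal by blast

lemma Min_r_set_G_one: "Min (r_set \<Lambda> ` G_one J) = ereal r_one"
proof -
  have "r_set \<Lambda> ` G_one J = ereal ` (\<lambda>A. mass A (beta \<Lambda> A)) ` G_one J"
    unfolding image_image using subsetD[OF G_one_subset_G_minus[of J]]
    by (intro image_cong) (auto simp: r_set_beta)
  then show ?thesis
    using mono_Min_commute[of ereal "(\<lambda>A. mass A (beta \<Lambda> A)) ` G_one J"] G_one_nonempty
    by (simp add: r_one_def mono_def)
qed

lemma r_one_le: "A \<in> G_one J \<Longrightarrow> r_one \<le> mass A (beta \<Lambda> A)"
  by (simp add: r_one_def)

lemma r_one_attained: "\<exists>A\<in>G_one J. r_one = mass A (beta \<Lambda> A)"
proof -
  have "r_one \<in> (\<lambda>A. mass A (beta \<Lambda> A)) ` G_one J"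
    unfolding r_one_def using G_one_nonempty by (intro Min_in) auto
  then show ?thesis by blast
qed

lemma two_r_one_le: "ereal (2 * r_one) \<le> Min ((\<lambda>A. 2 * r_set \<Lambda> A) ` G_one J)"
proof -
  have "ereal (2 * r_one) \<le> 2 * r_set \<Lambda> A" if "A \<in> G_one J" for A
  proof -
    have "2 * r_set \<Lambda> A = ereal 2 * ereal (mass A (beta \<Lambda> A))"
      using subsetD[OF G_one_subset_G_minus that] by (simp add: r_set_beta)
    then show ?thesis using r_one_le[OF that] by simp
  qed
  then show ?thesis using G_one_nonempty by simp
qed

lemma beta_feas: "A \<in> G_minus J \<Longrightarrow> beta \<Lambda> A \<in> feas A"
  using beta_optimal by (auto simp: optimal_def)

text \<open>For a single swap, the maximizer itself serves twice. Otherwise two coordinates are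
  exchanged on each side: under \<open>H1\<close> the member of \<Theta> is \<open>gamma2\<close>
  with partner \<open>gamma4\<close>, and under \<open>H2\<close> both are
  \<open>gamma4\<close>.\<close>

lemma efficient_pair:
  assumes H: "H1 \<Lambda> J \<and> \<Theta> = Theta1 \<Lambda> J \<or> H2 \<Lambda> J \<and> \<Theta> = Theta2 \<Lambda> J" and A: "A \<in> G_minus J"
  shows "\<exists>\<theta>\<in>\<Theta> \<inter> feas A. \<exists>\<theta>'\<in>feas A. 2 * r_one \<le> mass A \<theta> + mass A \<theta>'"
proof (cases "A \<in> G_one J")
  case True
  then have "beta \<Lambda> A \<in> \<Theta>" using H by (auto simp: Theta1_def Theta2_def Theta0_def)
  then show ?thesis using beta_feas[OF A] r_one_le[OF True] by force
next
  case False
  obtain l1 l2 l1' l2' where q: "(l1, l2, l1', l2') \<in> quads J" and l: "l1 \<notin> A" "l2 \<notin> A" "l1' \<in> A" "l2' \<in> A"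
    by (rule G_minus_far[OF A False], rule that)
  note g = gamma4_optimal[OF q l] gamma2_optimal[OF q l]
  have fin: "finite (quads J)" by (rule finite_subset[OF subset_UNIV]) simp
  from H show ?thesis
  proof
    assume H: "H1 \<Lambda> J \<and> \<Theta> = Theta1 \<Lambda> J"
    have "ereal (2 * r_one) \<le> z_val \<Lambda> l1 l1' + s_val \<Lambda> l1 l2 l1' l2'"
    proof -
      have "ereal (2 * r_one) \<le> Min ((\<lambda>(l1, l2, l1', l2'). z_val \<Lambda> l1 l1' + s_val \<Lambda> l1 l2 l1' l2') ` quads J)"
        using H order_trans[OF two_r_one_le] by (simp add: H1_def)
      also have "\<dots> \<le> z_val \<Lambda> l1 l1' + s_val \<Lambda> l1 l2 l1' l2'"
        using fin q by (intro Min_le) (auto simp: rev_image_eqI)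
      finally show ?thesis .
    qed
    then have "2 * r_one \<le> mass A (gamma2 \<Lambda> l1 l1') + mass A (gamma4 \<Lambda> l1 l2 l1' l2')"
      using g by simp
    moreover have "gamma2 \<Lambda> l1 l1' \<in> \<Theta>" using H q by (auto simp: Theta1_def quads_def)
    ultimately show ?thesis using g by blast
  next
    assume H: "H2 \<Lambda> J \<and> \<Theta> = Theta2 \<Lambda> J"
    have "ereal (2 * r_one) \<le> 2 * s_val \<Lambda> l1 l2 l1' l2'"
    proof -
      have "ereal (2 * r_one) \<le> Min ((\<lambda>(l1, l2, l1', l2'). 2 * s_val \<Lambda> l1 l2 l1' l2') ` quads J)"
        using H order_trans[OF two_r_one_le] by (simp add: H2_def)
      also have "\<dots> \<le> 2 * s_val \<Lambda> l1 l2 l1' l2'"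
        using fin q by (intro Min_le) (auto simp: rev_image_eqI)
      finally show ?thesis .
    qed
    also have "\<dots> = ereal 2 * ereal (mass A (gamma4 \<Lambda> l1 l2 l1' l2'))" using g by simp
    finally have "2 * r_one \<le> mass A (gamma4 \<Lambda> l1 l2 l1' l2') + mass A (gamma4 \<Lambda> l1 l2 l1' l2')"
      by simp
    moreover have "gamma4 \<Lambda> l1 l2 l1' l2' \<in> \<Theta>" using H q by (auto simp: Theta2_def)
    ultimately show ?thesis using g by blast
  qed
qed

text \<open>Both members of the pair have at most the optimal mass for \<open>A\<close>, so the
  bound on their sum shows that no set of \<open>G_minus J\<close> has a rate below
  \<open>r_one\<close>.\<close>

lemma r_star_eq:
  assumes "H1 \<Lambda> J \<or> H2 \<Lambda> J" shows "r_star \<Lambda> J = Min (r_set \<Lambda> ` G_one J)"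
proof -
  have "ereal r_one \<le> r_set \<Lambda> A" if A: "A \<in> G_minus J" for A
  proof -
    obtain \<theta> \<theta>' where "\<theta> \<in> feas A" "\<theta>' \<in> feas A" "2 * r_one \<le> mass A \<theta> + mass A \<theta>'"
      using assms efficient_pair[OF _ A] by (metis IntD2)
    then have "mass A \<theta> \<le> mass A (beta \<Lambda> A)" "mass A \<theta>' \<le> mass A (beta \<Lambda> A)"
      "2 * r_one \<le> mass A \<theta> + mass A \<theta>'"
      using beta_optimal[OF A] by (auto simp: optimal_def)
    then show ?thesis by (simp add: r_set_beta[OF A])
  qed
  moreover have "G_minus J \<noteq> {}" using G_one_nonempty G_one_subset_G_minus by blast
  ultimately have "Min (r_set \<Lambda> ` G_one J) \<le> Min (r_set \<Lambda> ` G_minus J)"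
    by (simp add: Min_r_set_G_one)
  moreover have "Min (r_set \<Lambda> ` G_minus J) \<le> Min (r_set \<Lambda> ` G_one J)"
    using G_one_nonempty G_one_subset_G_minus by (intro Min_antimono image_mono) auto
  ultimately show ?thesis by (simp add: r_star_def)
qed

lemma Theta_sublevel:
  assumes "\<theta> \<in> Theta1 \<Lambda> J \<union> Theta2 \<Lambda> J" shows "\<Lambda> \<theta> \<le> 0"
proof -
  have four: "\<Lambda> (gamma4 \<Lambda> l1 l2 l1' l2') \<le> 0" "\<Lambda> (gamma2 \<Lambda> l1 l1') \<le> 0"
    if q: "(l1, l2, l1', l2') \<in> quads J" for l1 l2 l1' l2'
    using gamma4_optimal(1)[OF q quads_swap(2-5)[OF q]] gamma2_optimal(1)[OF q quads_swap(2-5)[OF q]]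
    by (auto dest: feasD(3))
  \<comment> \<open>\<open>J\<close> and its complement have at least two elements each, so every
    pair extends to a quadruple, for which feasibility is known.\<close>
  have two: "\<Lambda> (gamma2 \<Lambda> l l') \<le> 0" if "l \<in> J" "l' \<notin> J" for l l'
  proof -
    have "card (- J) = CARD('n) - card J" by (simp add: Compl_eq_Diff_UNIV card_Diff_subset)
    then have "\<not> card J \<le> card {l}" "\<not> card (- J) \<le> card {l'}" using card_J by auto
    then have "\<not> J \<subseteq> {l}" "\<not> - J \<subseteq> {l'}" by (meson card_mono finite)+
    then obtain l2 l2' where "l2 \<in> J" "l2 \<noteq> l" "l2' \<notin> J" "l2' \<noteq> l'" by blast
    then have "(l, l2, l', l2') \<in> quads J" using that by (auto simp: quads_def)
    then show ?thesis by (rule four(2))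
  qed
  have "\<Lambda> (beta \<Lambda> A) \<le> 0" if "A \<in> G_one J" for A
    using beta_feas that G_one_subset_G_minus feasD(3) by blast
  then show ?thesis using assms four two by (auto simp: Theta1_def Theta2_def Theta0_def)
qed

lemma finite_Theta:
  "finite (Theta1 \<Lambda> J)" "Theta1 \<Lambda> J \<noteq> {}" "finite (Theta2 \<Lambda> J)" "Theta2 \<Lambda> J \<noteq> {}"
proof -
  have "{gamma2 \<Lambda> l l' | l l'. l \<in> J \<and> l' \<notin> J} = (\<lambda>(l, l'). gamma2 \<Lambda> l l') ` (J \<times> - J)"
    "{gamma4 \<Lambda> l1 l2 l1' l2' | l1 l2 l1' l2'. (l1, l2, l1', l2') \<in> quads J}
      = (\<lambda>(l1, l2, l1', l2'). gamma4 \<Lambda> l1 l2 l1' l2') ` quads J"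
    by (force simp: image_iff)+
  then have "finite {gamma2 \<Lambda> l l' | l l'. l \<in> J \<and> l' \<notin> J}"
    "finite {gamma4 \<Lambda> l1 l2 l1' l2' | l1 l2 l1' l2'. (l1, l2, l1', l2') \<in> quads J}"
    by simp_all
  then show "finite (Theta1 \<Lambda> J)" "Theta1 \<Lambda> J \<noteq> {}" "finite (Theta2 \<Lambda> J)" "Theta2 \<Lambda> J \<noteq> {}"
    using G_one_nonempty by (auto simp: Theta1_def Theta2_def Theta0_def)
qed

end

text \<open>A single swap attaining \<open>r_one\<close> bounds the error probability below at the
  same exponential rate that the pairs give for the second moment.\<close>

lemma (in tilted_walk) asymp_efficientI:
  assumes Th: "finite \<Theta>" "\<Theta> \<noteq> {}" "\<And>\<theta>. \<theta> \<in> \<Theta> \<Longrightarrow> \<Lambda> \<theta> \<le> 0"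
    and pair: "\<And>A. A \<in> G_minus J \<Longrightarrow> \<exists>\<theta>\<in>\<Theta> \<inter> feas A. \<exists>\<theta>'\<in>feas A. 2 * r_one \<le> mass A \<theta> + mass A \<theta>'"
  shows "asymp_efficient M X J Q \<Theta>"
proof -
  obtain A where A: "A \<in> G_minus J" "r_one = mass A (beta \<Lambda> A)"
    using r_one_attained G_one_subset_G_minus by blast
  have "0 < r_one" using opt_mass_pos[OF A(1) beta_optimal[OF A(1)]] A(2) by simp
  moreover have "0 < real (card \<Theta>) * real (card (G_minus J))"
    using Th G_minus_nonempty by (simp add: card_gt_0_iff)
  ultimately show ?thesis
    unfolding asymp_efficient_def
    using second_moment_bounds[OF Th _ pair] err_prob_lower[OF A(1) beta_optimal[OF A(1)]]
    unfolding A(2)[symmetric]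
    by (intro log_ratio_tendsto_1[of r_one "real (card \<Theta>) * real (card (G_minus J))"])
qed

theorem theorem5p2:
  fixes M :: "'a measure" and X :: "nat \<Rightarrow> 'a \<Rightarrow> real ^ 'n" and J :: "'n set"
    and \<Lambda> :: "real ^ 'n \<Rightarrow> ereal"
  assumes "prob_space M"
    and "prob_space.indep_vars M (\<lambda>_. borel) X {1..}"
    and "\<forall>i\<ge>1. distr M borel (X i) = distr M borel (X 1)"
    and "2 \<le> card J" and "card J + 2 \<le> CARD('n)"
    and "\<forall>k\<in>J. (\<integral>\<omega>. X 1 \<omega> $ k \<partial>M) > 0"
    and "\<forall>k\<in>- J. (\<integral>\<omega>. X 1 \<omega> $ k \<partial>M) < 0"
    and "\<Lambda> = cgf M (X 1)"
    and "open (edom \<Lambda>)"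
    and "\<forall>A\<in>G_minus J. interior (open_cone (edom (conjugate \<Lambda>))) \<inter> W A \<noteq> {}"
  shows "(H1 \<Lambda> J \<or> H2 \<Lambda> J \<longrightarrow> r_star \<Lambda> J = Min (r_set \<Lambda> ` G_one J))
    \<and> (\<forall>Q. (\<forall>\<theta>\<in>edom \<Lambda>. tilted M X \<theta> (Q \<theta>)) \<longrightarrow>
          (H1 \<Lambda> J \<longrightarrow> asymp_efficient M X J Q (Theta1 \<Lambda> J))
        \<and> (H2 \<Lambda> J \<longrightarrow> asymp_efficient M X J Q (Theta2 \<Lambda> J)))"
proof -
  interpret prob_space M by fact
  have meas: "X i \<in> borel_measurable M" if "1 \<le> i" for i
    using assms(2) that by (simp add: indep_vars_def)
  interpret gap_rule M "X 1" J
    using assms meas[of 1] by unfold_locales (simp_all del: One_nat_def)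
  have \<Lambda>: "\<Lambda> = cgf M (X 1)" by fact
  show ?thesis
    unfolding \<Lambda>
  proof (intro conjI impI allI)
    assume "H1 (cgf M (X 1)) J \<or> H2 (cgf M (X 1)) J"
    then show "r_star (cgf M (X 1)) J = Min (r_set (cgf M (X 1)) ` G_one J)" by (rule r_star_eq)
  next
    fix Q assume Q: "\<forall>\<theta>\<in>edom (cgf M (X 1)). tilted M X \<theta> (Q \<theta>)"
    then interpret tilted_walk M X J Q
      using meas by unfold_locales auto
    show "asymp_efficient M X J Q (Theta1 (cgf M (X 1)) J)" if "H1 (cgf M (X 1)) J"
      using finite_Theta(1,2) Theta_sublevel efficient_pair that by (intro asymp_efficientI) blast+
    show "asymp_efficient M X J Q (Theta2 (cgf M (X 1)) J)" if "H2 (cgf M (X 1)) J"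
      using finite_Theta(3,4) Theta_sublevel efficient_pair that by (intro asymp_efficientI) blast+
  qed
qed

end
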